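(* Let $n\ge 7$. Every maximal outerplanar graph $G$ with exactly $2n-3$ vertices satisfies that $K_n$ is a minor of the complement $\overline{G}$.
   Context: A graph is outerplanar if it has a planar embedding with all vertices on a single face; it is maximal outerplanar if no edge can be added while preserving outerplanarity. The complement $\overline{G}$ has the same vertex set as $G$, with two distinct vertices adjacent iff they are not adjacent in $G$. Minors are obtained by vertex deletions, edge deletions and edge contractions. *)

theory Defs
  imports "HOL-Analysis.Analysis"
begin

type_synonym 'a ugraph = "'a set \<times> 'a set set"

abbreviation verts :: "'a ugraph \<Rightarrow> 'a set" where "verts G \<equiv> fst G"

abbreviation edges :: "'a ugraph \<Rightarrow> 'a set set" where "edges G \<equiv> snd G"

definition simple_graph :: "'a ugraph \<Rightarrow> bool" where
  "simple_graph G \<longleftrightarrow> finite (verts G) \<and> (\<forall>e\<in>edges G. e \<subseteq> verts G \<and> card e = 2)"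

definition complement_graph :: "'a ugraph \<Rightarrow> 'a ugraph" where
  "complement_graph G =
     (verts G, {{u, v} | u v. u \<in> verts G \<and> v \<in> verts G \<and> u \<noteq> v \<and> {u, v} \<notin> edges G})"

definition complete_graph :: "nat \<Rightarrow> nat ugraph" where
  "complete_graph n = ({..<n}, {{u, v} | u v. u < n \<and> v < n \<and> u \<noteq> v})"

definition graph_isomorphic :: "'a ugraph \<Rightarrow> 'b ugraph \<Rightarrow> bool" where
  "graph_isomorphic G H \<longleftrightarrow>
     (\<exists>f. bij_betw f (verts G) (verts H) \<and> edges H = (\<lambda>e. f ` e) ` edges G)"


text \<open>Contracting the edge \<open>{u, v}\<close> reuses the name \<open>u\<close> for the new vertex. Filtering
  by cardinality removes the loop arising from \<open>{u, v}\<close>; parallel edges are merged because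
  edges form a set.\<close>

definition contract_edge :: "'a \<Rightarrow> 'a \<Rightarrow> 'a ugraph \<Rightarrow> 'a ugraph" where
  "contract_edge u v G =
     (verts G - {v}, {e \<in> (\<lambda>e. (\<lambda>x. if x = v then u else x) ` e) ` edges G. card e = 2})"

inductive minor_step :: "'a ugraph \<Rightarrow> 'a ugraph \<Rightarrow> bool" where
  delete_vertex: "v \<in> verts G \<Longrightarrow> minor_step G (verts G - {v}, {e \<in> edges G. v \<notin> e})"
| delete_edge: "e \<in> edges G \<Longrightarrow> minor_step G (verts G, edges G - {e})"
| contract: "{u, v} \<in> edges G \<Longrightarrow> u \<noteq> v \<Longrightarrow> minor_step G (contract_edge u v G)"

definition is_minor :: "'b ugraph \<Rightarrow> 'a ugraph \<Rightarrow> bool" where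
  "is_minor H G \<longleftrightarrow> (\<exists>G'. minor_step\<^sup>*\<^sup>* G G' \<and> graph_isomorphic G' H)"


text \<open>A planar embedding places the vertices at distinct points of the plane and draws every
  edge as a simple arc between its ends, such that an arc meets no further vertex and
  two arcs meet only in common end vertices.\<close>

definition planar_embedding ::
  "'a ugraph \<Rightarrow> ('a \<Rightarrow> complex) \<Rightarrow> ('a set \<Rightarrow> real \<Rightarrow> complex) \<Rightarrow> bool" where
  "planar_embedding G p \<gamma> \<longleftrightarrow>
     inj_on p (verts G) \<and>
     (\<forall>e\<in>edges G. arc (\<gamma> e) \<and> {pathstart (\<gamma> e), pathfinish (\<gamma> e)} = p ` e \<and>
        path_image (\<gamma> e) \<inter> p ` verts G = p ` e) \<and>
     (\<forall>e\<in>edges G. \<forall>f\<in>edges G. e \<noteq> f \<longrightarrow>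
        path_image (\<gamma> e) \<inter> path_image (\<gamma> f) = p ` (e \<inter> f))"

definition drawing ::
  "'a ugraph \<Rightarrow> ('a \<Rightarrow> complex) \<Rightarrow> ('a set \<Rightarrow> real \<Rightarrow> complex) \<Rightarrow> complex set" where
  "drawing G p \<gamma> = p ` verts G \<union> (\<Union>e\<in>edges G. path_image (\<gamma> e))"

definition faces ::
  "'a ugraph \<Rightarrow> ('a \<Rightarrow> complex) \<Rightarrow> ('a set \<Rightarrow> real \<Rightarrow> complex) \<Rightarrow> complex set set" where
  "faces G p \<gamma> = components (- drawing G p \<gamma>)"

text \<open>Faces are open and disjoint from the drawing, so a vertex lies \<^emph>\<open>on\<close> a face if it
  belongs to the boundary of that face. The face need not be the unbounded one.\<close>

definition outerplanar :: "'a ugraph \<Rightarrow> bool" where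
  "outerplanar G \<longleftrightarrow> simple_graph G \<and>
     (\<exists>p \<gamma>. planar_embedding G p \<gamma> \<and> (\<exists>F\<in>faces G p \<gamma>. p ` verts G \<subseteq> frontier F))"

definition maximal_outerplanar :: "'a ugraph \<Rightarrow> bool" where
  "maximal_outerplanar G \<longleftrightarrow> outerplanar G \<and>
     (\<forall>u\<in>verts G. \<forall>v\<in>verts G. u \<noteq> v \<and> {u, v} \<notin> edges G \<longrightarrow>
        \<not> outerplanar (verts G, insert {u, v} (edges G)))"

end

theory Submission
  imports Defs
begin

text \<open>In an outerplanar drawing all vertices touch one face, so by the theta-curve theorem there are
  neither three internally disjoint paths of length at least two between two vertices nor a cycle
  with two crossing chords. Longest cycles of biconnected subgraphs are therefore Hamiltonian, and
  gluing at cut vertices yields a circular order of the vertices in which no two edges cross.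

  For the minor, it suffices to choose \<open>n\<close> branch sets with at most two vertices each. By induction:
  two nonadjacent vertices without a common neighbour form a branch set that is compatible with
  everything else, and deleting them decreases \<open>n\<close> by one. If there is no such pair and \<open>n > 7\<close>, then
  some vertex \<open>h\<close> is adjacent to all others with at most one exception. Discarding \<open>h\<close> leaves a graph
  that is almost a path, in which the first and the last vertex can be paired repeatedly. The case of
  eleven vertices is settled by a decision tree over the presence of edges.\<close>

subsection \<open>Theta curves\<close>

text \<open>Counting shapes the combinatorial half. If \<open>n\<close> disjoint blocks of size at
  most two fit into \<open>2 * n - 3\<close> vertices, then at least three of them are singletons,
  and these must be pairwise nonadjacent in \<open>G\<close>. Deleting a pair keeps the relation
  between \<open>n\<close> and the number of vertices, whereas discarding a hub costs one vertex:
  the same \<open>n\<close> blocks must fit into \<open>2 * n - 4\<close> vertices, and only the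
  path-like structure of the rest makes up for this. The decision tree starts the induction:
  deleting a pair from eleven vertices would leave nine, below its range. The bridge from topology
  to combinatorics is a linear order of the vertices, a circle cut open. It survives restriction,
  rotation and reversal, so nothing has to be redrawn when vertices are deleted. On the topological
  side the obstacle is that the common face may lie on either side of a cycle, while the splitting
  of a closed curve by a chord is a statement about its inside; an inversion carries the outside to
  an inside.\<close>

definition theta_arcs :: "complex \<Rightarrow> complex \<Rightarrow> (real \<Rightarrow> complex) \<Rightarrow> (real \<Rightarrow> complex) \<Rightarrow> (real \<Rightarrow> complex) \<Rightarrow> bool" where
  "theta_arcs a b c1 c2 c \<longleftrightarrow>
     (\<forall>g\<in>{c1, c2, c}. arc g \<and> pathstart g = a \<and> pathfinish g = b) \<and>
     path_image c1 \<inter> path_image c2 = {a, b} \<and>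
     path_image c1 \<inter> path_image c = {a, b} \<and>
     path_image c2 \<inter> path_image c = {a, b}"

lemma theta_arcs_continuous_image:
  assumes "theta_arcs a b c1 c2 c" "continuous_on S h" "inj_on h S"
    and "path_image c1 \<union> path_image c2 \<union> path_image c \<subseteq> S"
  shows "theta_arcs (h a) (h b) (h \<circ> c1) (h \<circ> c2) (h \<circ> c)"
proof -
  have arcs: "arc (h \<circ> g) \<and> pathstart (h \<circ> g) = h a \<and> pathfinish (h \<circ> g) = h b" if "g \<in> {c1, c2, c}" for g
  proof -
    have "arc g" "pathstart g = a" "pathfinish g = b" "path_image g \<subseteq> S"
      using assms(1,4) that by (auto simp: theta_arcs_def)
    moreover have "arc (h \<circ> g)"
      unfolding arc_def using \<open>arc g\<close> \<open>path_image g \<subseteq> S\<close> assms(2,3)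
      by (metis arc_def comp_inj_on continuous_on_subset inj_on_subset path_continuous_image path_image_def)
    ultimately show ?thesis by (simp add: pathstart_compose pathfinish_compose)
  qed
  have "h ` A \<inter> h ` B = {h a, h b}" if "A \<inter> B = {a, b}" "A \<subseteq> S" "B \<subseteq> S" for A B
    using inj_on_image_Int[OF assms(3) that(2,3)] that(1) by auto
  then show ?thesis
    using arcs assms(1,4) unfolding theta_arcs_def path_image_compose by auto
qed

lemma Jordan_inside_outside_two_arcs:
  fixes c1 c2 :: "real \<Rightarrow> complex"
  assumes "arc c1" "arc c2" "pathstart c1 = a" "pathstart c2 = a" "pathfinish c1 = b" "pathfinish c2 = b"
    and "path_image c1 \<inter> path_image c2 = {a, b}"
  defines "J \<equiv> path_image c1 \<union> path_image c2"
  shows "compact J" "inside J \<noteq> {}" "open (inside J)" "open (outside J)" "connected (outside J)"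
proof -
  let ?c = "c1 +++ reversepath c2"
  have "simple_path ?c"
    by (rule simple_path_join_loop) (use assms in \<open>auto simp: arc_reversepath\<close>)
  moreover have "pathfinish ?c = pathstart ?c" using assms by simp
  moreover have "path_image ?c = J"
    using assms by (simp add: path_image_join)
  ultimately show "compact J" "inside J \<noteq> {}" "open (inside J)" "open (outside J)" "connected (outside J)"
    using Jordan_inside_outside[of ?c] compact_simple_path_image[of ?c] by auto
qed

lemma connected_inside_or_outside:
  fixes X J :: "complex set"
  assumes "connected X" "X \<inter> J = {}" "compact J"
  shows "X \<subseteq> inside J \<or> X \<subseteq> outside J"
proof (rule ccontr)
  assume "\<not> ?thesis"
  then obtain x y where "x \<in> X" "x \<notin> inside J" "y \<in> X" "y \<notin> outside J" by blast
  then have "inside J \<inter> X \<noteq> {}" "outside J \<inter> X \<noteq> {}"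
    using assms(2) inside_Un_outside[of J] by blast+
  moreover have "open (inside J)" "open (outside J)"
    using assms(3) by (auto simp: open_inside open_outside compact_imp_closed)
  moreover have "X \<subseteq> inside J \<union> outside J" using assms(2) by auto
  moreover have "inside J \<inter> outside J \<inter> X = {}" by (simp add: inside_Int_outside)
  ultimately show False using \<open>connected X\<close> unfolding connected_def by blast
qed

text \<open>A chord \<open>c\<close> inside the closed curve splits its inside into two regions, one
  bounded by \<open>c1\<close> and \<open>c\<close>, the other by \<open>c2\<close> and
  \<open>c\<close>. The connected set \<open>F\<close> lies in one of them, and the closure of that
  region misses the inner points of the other arc, although \<open>F\<close> touches both
  arcs.\<close>

lemma theta_no_chord_inside:
  assumes th: "theta_arcs a b c1 c2 c" and "connected F"
    and disj: "F \<inter> (path_image c1 \<union> path_image c2 \<union> path_image c) = {}"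
    and F: "F \<subseteq> inside (path_image c1 \<union> path_image c2)"
    and x1: "x1 \<in> closure F" "x1 \<in> path_image c1 - {a, b}"
    and x2: "x2 \<in> closure F" "x2 \<in> path_image c2 - {a, b}"
  shows "path_image c \<inter> inside (path_image c1 \<union> path_image c2) = {}"
proof (rule ccontr)
  assume ne: "\<not> ?thesis"
  have "a \<noteq> b"
    using th arc_distinct_ends[of c1] unfolding theta_arcs_def by auto
  have arcs: "arc c1" "arc c2" "arc c" using th by (auto simp: theta_arcs_def)
  note sp = arcs[THEN arc_imp_simple_path]
  let ?I1 = "inside (path_image c1 \<union> path_image c)" and ?I2 = "inside (path_image c2 \<union> path_image c)"
  have sub: "?I1 \<inter> ?I2 = {}" "?I1 \<union> ?I2 \<union> (path_image c - {a, b}) = inside (path_image c1 \<union> path_image c2)"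
    using split_inside_simple_closed_curve[OF sp(1) _ _ sp(2) _ _ sp(3) _ _ \<open>a \<noteq> b\<close> _ _ _ ne] th
    unfolding theta_arcs_def by auto
  have closed: "closed (path_image g \<union> path_image c)" if "g \<in> {c1, c2}" for g
    using arcs that by (auto simp: closed_arc_image)
  have cl: "closure ?I1 \<subseteq> path_image c1 \<union> path_image c \<union> ?I1" "closure ?I2 \<subseteq> path_image c2 \<union> path_image c \<union> ?I2"
    by (auto intro!: closure_inside_subset closed)
  have "F \<subseteq> ?I1 \<union> ?I2" using F disj sub(2) by blast
  moreover have "open ?I1" "open ?I2" by (auto intro!: open_inside closed)
  ultimately have "F \<subseteq> ?I1 \<or> F \<subseteq> ?I2"
    using \<open>connected F\<close> sub(1) unfolding connected_def by blast
  moreover have "x1 \<notin> path_image c2 \<union> path_image c" "x2 \<notin> path_image c1 \<union> path_image c"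
    using th x1(2) x2(2) unfolding theta_arcs_def by blast+
  moreover have "x1 \<notin> ?I2" "x2 \<notin> ?I1"
    using x1(2) x2(2) sub(2) inside_no_overlap[of "path_image c1 \<union> path_image c2"] by blast+
  ultimately have "x1 \<notin> closure ?I2" "x2 \<notin> closure ?I1" "F \<subseteq> ?I1 \<or> F \<subseteq> ?I2"
    using cl by blast+
  then show False
    using closure_mono[of F ?I1] closure_mono[of F ?I2] x1(1) x2(1) by blast
qed

text \<open>The image of the outside is connected and avoids the image of \<open>J\<close>, so only
  its side is in question. If it were the outer side, the inverse map would send that side, minus
  \<open>0\<close>, to one side of \<open>J\<close>: the inside is impossible because points outside
  \<open>J\<close> are hit, the outside because points of large norm return close to
  \<open>w\<close>.\<close>

lemma inversion_outside_to_inside: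
  fixes J :: "complex set"
  assumes J: "compact J" "connected (outside J)" and w: "w \<in> inside J"
  defines "g \<equiv> \<lambda>z. inverse (z - w)"
  shows "g ` outside J \<subseteq> inside (g ` J)"
proof -
  have wJ: "w \<notin> J" "w \<notin> outside J"
    using w inside_no_overlap[of J] inside_Int_outside[of J] by blast+
  have cont: "continuous_on (-{w}) g"
    unfolding g_def by (intro continuous_intros) auto
  have cJ: "compact (g ` J)"
    by (rule compact_continuous_image[OF continuous_on_subset[OF cont] J(1)]) (use wJ in auto)
  have "connected (g ` outside J)"
    by (rule connected_continuous_image[OF continuous_on_subset[OF cont] J(2)]) (use wJ in auto)
  moreover have "g ` outside J \<inter> g ` J = {}"
  proof -
    have "inj g" by (auto simp: g_def inj_def)
    then show ?thesis using outside_no_overlap[of J] by (metis image_Int image_empty)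
  qed
  ultimately consider "g ` outside J \<subseteq> inside (g ` J)" | "g ` outside J \<subseteq> outside (g ` J)"
    using connected_inside_or_outside cJ by blast
  then show ?thesis
  proof cases
    case 2
    \<comment> \<open>The point \<open>0\<close> is the image of infinity under \<open>g\<close>,
      where the inverse map \<open>k\<close> has its pole; deleting it does not disconnect an open
      connected set in the plane.\<close>
    define Y where "Y = outside (g ` J) - {0}"
    define k where "k = (\<lambda>z. w + inverse z)"
    have kg: "k (g z) = z" if "z \<noteq> w" for z using that by (simp add: k_def g_def)
    have gk: "g (k z) = z" for z by (simp add: k_def g_def)
    have "connected Y"
      unfolding Y_def using cJ 
      by (intro connected_open_delete open_outside connected_outside) (auto simp: compact_imp_closed compact_imp_bounded)
    then have conn: "connected (k ` Y)"
      unfolding k_def by (intro connected_continuous_image continuous_intros) (auto simp: Y_def)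
    have "k ` Y \<inter> J = {}"
    proof -
      have "z \<notin> J" if "y \<in> Y" "z = k y" for y z
        using that gk[of y] outside_no_overlap[of "g ` J"] unfolding Y_def by (metis DiffD1 disjoint_iff imageI)
      then show ?thesis by auto
    qed
    then consider "k ` Y \<subseteq> inside J" | "k ` Y \<subseteq> outside J"
      using conn J(1) connected_inside_or_outside by blast
    then show ?thesis
    proof cases
      case 1
      have "outside J \<noteq> {}" using J(1) by (simp add: outside_bounded_nonempty compact_imp_bounded)
      then obtain z where z: "z \<in> outside J" by blast
      then have "g z \<in> Y" using 2 wJ by (auto simp: Y_def g_def)
      then have "z \<in> inside J" using 1 kg wJ z by (metis image_subset_iff)
      then show ?thesis using z inside_Int_outside[of J] by blast
    next
      case 2
      obtain e where e: "e > 0" "ball w e \<subseteq> inside J"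
        using w J(1) by (meson compact_imp_closed open_contains_ball open_inside)
      obtain B where B: "\<And>z. z \<notin> outside (g ` J) \<Longrightarrow> norm z \<le> B"
        using cobounded_outside[OF compact_imp_bounded[OF cJ]] unfolding bounded_iff by auto
      \<comment> \<open>Norm above \<open>B\<close> places \<open>z\<close> outside the image curve,
        norm above \<open>1/e\<close> places \<open>k z\<close> in the ball around
        \<open>w\<close>.\<close>
      define z :: complex where "z = of_real (max B (1/e) + 1 + \<bar>B\<bar>)"
      have nz: "norm z > B" "norm z > 1/e" using e unfolding z_def norm_of_real by (auto simp: max_def)
      moreover have "0 < 1/e" using e by simp
      ultimately have "z \<noteq> 0" "z \<in> outside (g ` J)" using B[of z] by force+
      then have "k z \<in> outside J" using 2 by (auto simp: Y_def)
      moreover have "dist w (k z) < e"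
      proof -
        have "inverse (norm z) < inverse (1 / e)"
          using nz(2) \<open>0 < 1/e\<close> by (rule less_imp_inverse_less)
        then show ?thesis by (simp add: k_def dist_norm norm_inverse)
      qed
      then have "k z \<in> inside J" using e by auto
      ultimately show ?thesis using inside_Int_outside[of J] by blast
    qed
  qed
qed

text \<open>Each of \<open>F\<close> and the open arc \<open>c\<close> lies on one side of
  \<open>J\<close>, so it remains to exclude a common side. \<open>F\<close> is an arbitrary
  connected set rather than a face because an open chord takes its place when crossing chords are
  excluded.\<close>

lemma theta_opposite_sides:
  assumes th: "theta_arcs a b c1 c2 c" and conF: "connected F"
    and disj: "F \<inter> (path_image c1 \<union> path_image c2 \<union> path_image c) = {}"
    and x1: "x1 \<in> closure F" "x1 \<in> path_image c1 - {a, b}"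
    and x2: "x2 \<in> closure F" "x2 \<in> path_image c2 - {a, b}"
  defines "J \<equiv> path_image c1 \<union> path_image c2"
  shows "F \<subseteq> inside J \<and> path_image c - {a, b} \<subseteq> outside J \<or>
         F \<subseteq> outside J \<and> path_image c - {a, b} \<subseteq> inside J"
proof -
  have arcs: "arc c1" "arc c2" "arc c" and ends: "pathstart c = a" "pathfinish c = b"
    using th by (auto simp: theta_arcs_def)
  have J: "compact J" "inside J \<noteq> {}" "open (inside J)" "open (outside J)" "connected (outside J)"
    unfolding J_def using Jordan_inside_outside_two_arcs[of c1 c2 a b] th by (auto simp: theta_arcs_def)
  have "connected (path_image c - {a, b})"
    using connected_simple_path_endless[OF arc_imp_simple_path[OF arcs(3)]] ends by simp
  moreover have cJ: "(path_image c - {a, b}) \<inter> J = {}"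
    using th unfolding J_def theta_arcs_def by blast
  ultimately have c: "path_image c - {a, b} \<subseteq> inside J \<or> path_image c - {a, b} \<subseteq> outside J"
    using connected_inside_or_outside J(1) by blast
  have F: "F \<subseteq> inside J \<or> F \<subseteq> outside J"
    using connected_inside_or_outside[OF conF _ J(1)] disj unfolding J_def by blast
  have "path_image c - {a, b} \<noteq> {}"
    using nonempty_simple_path_endless[OF arc_imp_simple_path[OF arcs(3)]] ends by simp
  then obtain y where y: "y \<in> path_image c - {a, b}" by blast
  have "\<not> path_image c - {a, b} \<subseteq> inside J" if "F \<subseteq> inside J"
    using theta_no_chord_inside[OF th conF disj that[unfolded J_def] x1 x2] y unfolding J_def by blast
  moreover have "\<not> path_image c - {a, b} \<subseteq> outside J" if "F \<subseteq> outside J"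
  proof
    assume co: "path_image c - {a, b} \<subseteq> outside J"
    \<comment> \<open>Inversion at a point inside \<open>J\<close> reduces this case to the previous one.\<close>
    obtain w where w: "w \<in> inside J" using J by blast
    define g where "g = (\<lambda>z. inverse (z - w))"
    have wn: "w \<notin> J" "w \<notin> outside J"
      using w inside_no_overlap[of J] inside_Int_outside[of J] by blast+
    have wc: "w \<notin> path_image c"
      using wn co th unfolding J_def theta_arcs_def by blast
    have cont: "continuous_on (-{w}) g"
      unfolding g_def by (intro continuous_intros) auto
    have inj: "inj_on g (-{w})" by (auto simp: g_def inj_on_def)
    have wF: "w \<notin> closure F"
      using closure_mono[OF that] closure_outside_subset[of J] J(1) wn compact_imp_closed by blast
    have sub: "g ` outside J \<subseteq> inside (g ` J)"
      unfolding g_def by (rule inversion_outside_to_inside) fact+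
    have th': "theta_arcs (g a) (g b) (g \<circ> c1) (g \<circ> c2) (g \<circ> c)"
      by (rule theta_arcs_continuous_image[OF th cont inj]) (use wn wc in \<open>auto simp: J_def\<close>)
    have gJ: "g ` J = path_image (g \<circ> c1) \<union> path_image (g \<circ> c2)"
      by (simp add: J_def path_image_compose image_Un)
    have cl: "g x \<in> closure (g ` F)" if "x \<in> closure F" for x
      using image_closure_subset[of F g "closure (g ` F)"] continuous_on_subset[OF cont, of "closure F"] wF that
      by (auto simp: closure_subset)
    have "F \<subseteq> -{w}" using wF closure_subset by blast
    have "path_image (g \<circ> c) \<inter> inside (g ` J) = {}"
      unfolding gJ
    proof (rule theta_no_chord_inside[OF th'])
      show "connected (g ` F)"
        by (rule connected_continuous_image[OF continuous_on_subset[OF cont] conF]) fact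
      show "g ` F \<inter> (path_image (g \<circ> c1) \<union> path_image (g \<circ> c2) \<union> path_image (g \<circ> c)) = {}"
        using disj by (auto simp: path_image_compose g_def)
      show "g ` F \<subseteq> inside (path_image (g \<circ> c1) \<union> path_image (g \<circ> c2))"
        using sub that gJ by auto
      show "g x1 \<in> closure (g ` F)" "g x2 \<in> closure (g ` F)" using cl x1 x2 by auto
      show "g x1 \<in> path_image (g \<circ> c1) - {g a, g b}" "g x2 \<in> path_image (g \<circ> c2) - {g a, g b}"
        using x1(2) x2(2) by (auto simp: path_image_compose g_def)
    qed
    moreover have "g y \<in> path_image (g \<circ> c)" "g y \<in> inside (g ` J)"
      using y co sub by (auto simp: path_image_compose)
    ultimately show False by blast
  qed
  ultimately show ?thesis using c F by blast
qed

text \<open>The closure of one side of the closed curve adds only points of the curve, so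
  \<open>F\<close> cannot touch inner points of an arc on the other side.\<close>

lemma theta_third_arc_untouched:
  assumes th: "theta_arcs a b c1 c2 c" and conF: "connected F"
    and disj: "F \<inter> (path_image c1 \<union> path_image c2 \<union> path_image c) = {}"
    and x1: "x1 \<in> closure F" "x1 \<in> path_image c1 - {a, b}"
    and x2: "x2 \<in> closure F" "x2 \<in> path_image c2 - {a, b}"
    and x3: "x3 \<in> closure F" "x3 \<in> path_image c - {a, b}"
  shows False
proof -
  let ?J = "path_image c1 \<union> path_image c2"
  have "compact ?J" using th by (auto simp: theta_arcs_def intro!: compact_Un compact_arc_image)
  then have cl: "closure (inside ?J) \<subseteq> ?J \<union> inside ?J" "closure (outside ?J) \<subseteq> ?J \<union> outside ?J"
    by (auto intro!: closure_inside_subset closure_outside_subset compact_imp_closed)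
  have "x3 \<notin> ?J" using x3 th unfolding theta_arcs_def by blast
  then show False
    using theta_opposite_sides[OF th conF disj x1 x2]
  proof (elim disjE conjE)
    assume "F \<subseteq> inside ?J" "path_image c - {a, b} \<subseteq> outside ?J"
    then have "x3 \<in> closure (inside ?J)" "x3 \<in> outside ?J"
      using x3 closure_mono by blast+
    then show False using cl \<open>x3 \<notin> ?J\<close> inside_Int_outside[of ?J] by blast
  next
    assume "F \<subseteq> outside ?J" "path_image c - {a, b} \<subseteq> inside ?J"
    then have "x3 \<in> closure (outside ?J)" "x3 \<in> inside ?J"
      using x3 closure_mono by blast+
    then show False using cl \<open>x3 \<notin> ?J\<close> inside_Int_outside[of ?J] by blast
  qed
qed

subsection \<open>Paths in an outerplanar drawing\<close>

text \<open>Needed for chords: the ends of a chord lie in the closure of the open chord, which can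
  then play the part of the touching set \<open>F\<close>.\<close>

lemma path_image_subset_closure_endless:
  assumes "simple_path c"
  shows "path_image c \<subseteq> closure (path_image c - {pathstart c, pathfinish c})"
proof -
  have "c ` closure {0<..<1} \<subseteq> closure (c ` {0<..<1})"
    using assms by (intro image_closure_subset) (auto simp: closure_subset simple_path_def path_def)
  then show ?thesis unfolding simple_path_endless[OF assms] by (simp add: path_image_def)
qed

fun path_edges :: "'a list \<Rightarrow> 'a set set" where
  "path_edges (x # y # zs) = insert {x, y} (path_edges (y # zs))"
| "path_edges _ = {}"

lemma path_edges_subset: "e \<in> path_edges xs \<Longrightarrow> e \<subseteq> set xs"
  by (induction xs rule: path_edges.induct) auto

lemma Union_path_edges: "length xs \<ge> 2 \<Longrightarrow> \<Union>(path_edges xs) = set xs"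
proof (induction xs rule: path_edges.induct)
  case (1 x y zs)
  then show ?case by (cases zs) auto
qed auto

lemma path_edges_append: "path_edges (xs @ y # ys) = path_edges (xs @ [y]) \<union> path_edges (y # ys)"
proof (induction xs rule: path_edges.induct)
  case ("2_2" x)
  then show ?case by (cases ys) auto
qed auto

lemma path_edges_rev: "path_edges (rev xs) = path_edges xs"
proof (induction xs rule: path_edges.induct)
  case (1 x y zs)
  then show ?case by (simp add: path_edges_append[of "rev zs" y "[x]"] insert_commute)
qed auto

lemma path_edges_subset_edges: "successively (\<lambda>x y. {x, y} \<in> E) xs \<Longrightarrow> path_edges xs \<subseteq> E"
  by (induction xs rule: path_edges.induct) auto

lemma ends_notin_path_edges:
  assumes "us \<noteq> []" "distinct (a # us @ [b])"
  shows "{a, b} \<notin> path_edges (a # us @ [b])"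
proof -
  obtain u us' where us: "us = u # us'" using assms(1) by (cases us) auto
  have "{a, b} \<notin> path_edges (us @ [b])" using assms(2) path_edges_subset by fastforce
  then show ?thesis using assms(2) by (auto simp: us doubleton_eq_iff)
qed

locale outer_drawing =
  fixes V :: "'a set" and E :: "'a set set" and p :: "'a \<Rightarrow> complex"
    and \<gamma> :: "'a set \<Rightarrow> real \<Rightarrow> complex" and F :: "complex set"
  assumes simple: "simple_graph (V, E)"
    and embedding: "planar_embedding (V, E) p \<gamma>"
    and connected_face: "connected F"
    and face_disjoint: "F \<inter> drawing (V, E) p \<gamma> = {}"
    and vertices_on_face: "p ` V \<subseteq> closure F"
begin

abbreviation adj :: "'a \<Rightarrow> 'a \<Rightarrow> bool" where "adj u v \<equiv> {u, v} \<in> E"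

definition path_drawing :: "'a list \<Rightarrow> complex set" where
  "path_drawing xs = (\<Union>e\<in>path_edges xs. path_image (\<gamma> e))"

lemma edge_card: "e \<in> E \<Longrightarrow> card e = 2" and edge_subset: "e \<in> E \<Longrightarrow> e \<subseteq> V"
  using simple by (auto simp: simple_graph_def)

lemma inj_p: "inj_on p V"
  using embedding by (simp add: planar_embedding_def)

lemma edge_arc:
  assumes "{x, y} \<in> E"
  obtains g where "arc g" "pathstart g = p x" "pathfinish g = p y" "path_image g = path_image (\<gamma> {x, y})"
proof -
  have e: "arc (\<gamma> {x, y})" "{pathstart (\<gamma> {x, y}), pathfinish (\<gamma> {x, y})} = {p x, p y}"
    using embedding assms unfolding planar_embedding_def by force+
  then consider "pathstart (\<gamma> {x, y}) = p x" "pathfinish (\<gamma> {x, y}) = p y"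
    | "pathstart (\<gamma> {x, y}) = p y" "pathfinish (\<gamma> {x, y}) = p x"
    by (auto simp: doubleton_eq_iff)
  then show ?thesis
    by cases (use that[of "\<gamma> {x, y}"] that[of "reversepath (\<gamma> {x, y})"] e in \<open>auto simp: arc_reversepath\<close>)
qed

lemma edge_images_Int:
  "e \<in> E \<Longrightarrow> f \<in> E \<Longrightarrow> e \<noteq> f \<Longrightarrow> path_image (\<gamma> e) \<inter> path_image (\<gamma> f) = p ` (e \<inter> f)"
  using embedding unfolding planar_embedding_def by simp

lemma edge_image_vertices: "e \<in> E \<Longrightarrow> path_image (\<gamma> e) \<inter> p ` V = p ` e"
  using embedding unfolding planar_embedding_def by simp

lemma path_drawing_disjoint_face: "path_edges xs \<subseteq> E \<Longrightarrow> F \<inter> path_drawing xs = {}"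
  using face_disjoint unfolding drawing_def path_drawing_def by fastforce

lemma vertex_in_path_drawing:
  assumes "path_edges xs \<subseteq> E" "length xs \<ge> 2" "x \<in> set xs"
  shows "p x \<in> path_drawing xs"
proof -
  obtain e where "e \<in> path_edges xs" "x \<in> e" using Union_path_edges[OF assms(2)] assms(3) by blast
  then show ?thesis using edge_image_vertices[of e] assms(1) unfolding path_drawing_def by blast
qed

lemma path_drawings_Int:
  assumes "path_edges xs \<subseteq> E" "path_edges ys \<subseteq> E" "path_edges xs \<inter> path_edges ys = {}"
  shows "path_drawing xs \<inter> path_drawing ys \<subseteq> p ` (set xs \<inter> set ys)"
proof
  fix z assume "z \<in> path_drawing xs \<inter> path_drawing ys"
  then obtain e f where ef: "e \<in> path_edges xs" "f \<in> path_edges ys" "z \<in> path_image (\<gamma> e)" "z \<in> path_image (\<gamma> f)"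
    unfolding path_drawing_def by blast
  then have "z \<in> p ` (e \<inter> f)"
    using edge_images_Int[of e f] assms by blast
  then show "z \<in> p ` (set xs \<inter> set ys)"
    using path_edges_subset[OF ef(1)] path_edges_subset[OF ef(2)] by blast
qed

lemma arc_of_path:
  assumes "length xs \<ge> 2" "distinct xs" "successively adj xs"
  shows "\<exists>g. arc g \<and> pathstart g = p (hd xs) \<and> pathfinish g = p (last xs) \<and> path_image g = path_drawing xs"
  using assms
proof (induction xs rule: path_edges.induct)
  case (1 x y zs)
  obtain g where g: "arc g" "pathstart g = p x" "pathfinish g = p y" "path_image g = path_image (\<gamma> {x, y})"
    using edge_arc[of x y] "1.prems" by auto
  show ?case
  proof (cases zs)
    case Nil
    then show ?thesis using g by (auto simp: path_drawing_def)
  next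
    case (Cons z zs')
    then obtain h where h: "arc h" "pathstart h = p y" "pathfinish h = p (last (y # zs))" "path_image h = path_drawing (y # zs)"
      using 1 by auto
    have "path_edges [x, y] \<inter> path_edges (y # zs) = {}"
      using "1.prems"(2) path_edges_subset by fastforce
    then have "path_image g \<inter> path_image h \<subseteq> p ` (set [x, y] \<inter> set (y # zs))"
      using path_drawings_Int[of "[x, y]" "y # zs"] path_edges_subset_edges[OF "1.prems"(3)] g(4) h(4)
      by (auto simp: path_drawing_def)
    also have "\<dots> \<subseteq> {pathstart h}" using "1.prems"(2) h by auto
    finally have "arc (g +++ h)" by (intro arc_join) (use g h in auto)
    moreover have "path_image (g +++ h) = path_drawing (x # y # zs)"
      using g h by (auto simp: path_image_join path_drawing_def)
    ultimately show ?thesis using g h by (intro exI[of _ "g +++ h"]) auto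
  qed
qed auto

text \<open>A common edge would have both ends in \<open>{a, b}\<close>, hence be
  \<open>{a, b}\<close> itself, which does not occur on a path with an inner vertex. So an inner
  vertex is demanded of one path, and \<open>ws\<close> may be empty.\<close>

lemma path_drawings_Int_ends:
  assumes "us \<noteq> []" "distinct (a # us @ ws @ [b])"
    and "successively adj (a # us @ [b])" "successively adj (a # ws @ [b])"
  shows "path_drawing (a # us @ [b]) \<inter> path_drawing (a # ws @ [b]) = {p a, p b}"
proof -
  note E = assms(3,4)[THEN path_edges_subset_edges]
  have "e \<notin> path_edges (a # ws @ [b])" if e: "e \<in> path_edges (a # us @ [b])" for e
  proof
    assume e': "e \<in> path_edges (a # ws @ [b])"
    have "e \<subseteq> {a, b}" using path_edges_subset[OF e] path_edges_subset[OF e'] assms(2) by auto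
    moreover have "card e = 2" using e E edge_card by blast
    ultimately have "e = {a, b}" using assms(2) by (intro card_subset_eq) auto
    then show False using ends_notin_path_edges[of us a b] assms e by auto
  qed
  then have "path_edges (a # us @ [b]) \<inter> path_edges (a # ws @ [b]) = {}" by blast
  from path_drawings_Int[OF E this]
  have "path_drawing (a # us @ [b]) \<inter> path_drawing (a # ws @ [b]) \<subseteq> {p a, p b}"
    using assms(2) by auto
  moreover have "p x \<in> path_drawing (a # us @ [b])" "p x \<in> path_drawing (a # ws @ [b])" if "x \<in> {a, b}" for x
    using that by (auto intro!: vertex_in_path_drawing E)
  ultimately show ?thesis by blast
qed

text \<open>\<open>zs\<close> may be empty: the third arc is then a single edge, as required for
  chords of a cycle.\<close>

lemma theta_of_paths:
  assumes "us \<noteq> []" "ws \<noteq> []" "distinct (a # us @ ws @ zs @ [b])"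
    and "successively adj (a # us @ [b])" "successively adj (a # ws @ [b])" "successively adj (a # zs @ [b])"
  obtains c1 c2 c where "theta_arcs (p a) (p b) c1 c2 c"
    "path_image c1 = path_drawing (a # us @ [b])"
    "path_image c2 = path_drawing (a # ws @ [b])"
    "path_image c = path_drawing (a # zs @ [b])"
proof -
  obtain c1 c2 c where c:
    "arc c1" "pathstart c1 = p a" "pathfinish c1 = p b" "path_image c1 = path_drawing (a # us @ [b])"
    "arc c2" "pathstart c2 = p a" "pathfinish c2 = p b" "path_image c2 = path_drawing (a # ws @ [b])"
    "arc c" "pathstart c = p a" "pathfinish c = p b" "path_image c = path_drawing (a # zs @ [b])"
    using arc_of_path[OF _ _ assms(4)] arc_of_path[OF _ _ assms(5)] arc_of_path[OF _ _ assms(6)] assms(3)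
    by auto
  have "path_image c1 \<inter> path_image c2 = {p a, p b}" "path_image c1 \<inter> path_image c = {p a, p b}"
    "path_image c2 \<inter> path_image c = {p a, p b}"
    unfolding c by (rule path_drawings_Int_ends; use assms in auto)+
  then have "theta_arcs (p a) (p b) c1 c2 c"
    unfolding theta_arcs_def using c by simp
  then show ?thesis using that c by blast
qed

lemma interior_vertex_touches:
  assumes "x \<in> set us" "distinct (a # us @ [b])" "set (a # us @ [b]) \<subseteq> V" "successively adj (a # us @ [b])"
  shows "p x \<in> closure F" "p x \<in> path_drawing (a # us @ [b]) - {p a, p b}"
proof -
  show "p x \<in> closure F" using vertices_on_face assms by auto
  have "p x \<noteq> p a" "p x \<noteq> p b" using inj_on_eq_iff[OF inj_p] assms by auto
  then show "p x \<in> path_drawing (a # us @ [b]) - {p a, p b}"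
    using vertex_in_path_drawing[OF path_edges_subset_edges[OF assms(4)]] assms(1) by auto
qed

text \<open>Each path has an inner vertex, and all vertices lie in the closure of \<open>F\<close>;
  so \<open>F\<close> would touch inner points of all three arcs.\<close>

lemma no_theta:
  assumes "us \<noteq> []" "ws \<noteq> []" "zs \<noteq> []" "distinct (a # us @ ws @ zs @ [b])"
    and V: "set (a # us @ ws @ zs @ [b]) \<subseteq> V"
    and adj: "successively adj (a # us @ [b])" "successively adj (a # ws @ [b])" "successively adj (a # zs @ [b])"
  shows False
proof -
  obtain c1 c2 c where c: "theta_arcs (p a) (p b) c1 c2 c"
    "path_image c1 = path_drawing (a # us @ [b])"
    "path_image c2 = path_drawing (a # ws @ [b])"
    "path_image c = path_drawing (a # zs @ [b])"
    using theta_of_paths[OF assms(1,2,4) adj] by blast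
  have d: "F \<inter> (path_image c1 \<union> path_image c2 \<union> path_image c) = {}"
    unfolding c using adj by (simp add: Int_Un_distrib path_drawing_disjoint_face path_edges_subset_edges)
  have t: "p (hd us) \<in> closure F" "p (hd us) \<in> path_image c1 - {p a, p b}"
    "p (hd ws) \<in> closure F" "p (hd ws) \<in> path_image c2 - {p a, p b}"
    "p (hd zs) \<in> closure F" "p (hd zs) \<in> path_image c - {p a, p b}"
    unfolding c
    using interior_vertex_touches[of "hd us" us a b] interior_vertex_touches[of "hd ws" ws a b]
      interior_vertex_touches[of "hd zs" zs a b] assms by simp_all
  show False by (rule theta_third_arc_untouched[OF c(1) connected_face d t])
qed

text \<open>\<open>F\<close> touches both arcs of the cycle between the ends of either chord, so
  each open chord lies on the side opposite to \<open>F\<close>, and both lie on the same side. But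
  the open chord from \<open>b\<close> to \<open>d\<close> is itself a connected set touching the
  two arcs between \<open>a\<close> and \<open>c\<close>, so the chord from \<open>a\<close> to
  \<open>c\<close> must lie opposite to it.\<close>

lemma no_crossing_chords:
  assumes dist: "distinct (a # us @ b # ws @ c # xs @ d # ys)"
    and V: "set (a # us @ b # ws @ c # xs @ d # ys) \<subseteq> V"
    and cyc: "successively adj (a # us @ b # ws @ c # xs @ d # ys @ [a])"
    and ac: "adj a c" and bd: "adj b d"
  shows False
proof -
  let ?P1 = "us @ b # ws" and ?P2 = "rev ys @ d # rev xs"
  let ?Q1 = "ws @ c # xs" and ?Q2 = "rev us @ a # rev ys"
  have P: "successively adj (a # ?P1 @ [c])" "successively adj (a # ?P2 @ [c])"
    and Q: "successively adj (b # ?Q1 @ [d])" "successively adj (b # ?Q2 @ [d])"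
    using cyc by (auto simp: successively_append_iff successively_Cons insert_commute hd_append hd_rev last_rev split: if_splits)
  obtain c1 c2 e where c: "theta_arcs (p a) (p c) c1 c2 e"
    "path_image c1 = path_drawing (a # ?P1 @ [c])"
    "path_image c2 = path_drawing (a # ?P2 @ [c])"
    "path_image e = path_drawing (a # [] @ [c])"
    by (rule theta_of_paths[OF _ _ _ P, of "[]"]) (use dist ac in auto)
  obtain d1 d2 f where d: "theta_arcs (p b) (p d) d1 d2 f"
    "path_image d1 = path_drawing (b # ?Q1 @ [d])"
    "path_image d2 = path_drawing (b # ?Q2 @ [d])"
    "path_image f = path_drawing (b # [] @ [d])"
    by (rule theta_of_paths[OF _ _ _ Q, of "[]"]) (use dist bd in auto)
  \<comment> \<open>The cycle is read twice, cut at \<open>a\<close> and \<open>c\<close> and cut at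
    \<open>b\<close> and \<open>d\<close>; both readings have the same edges and hence the same
    point set \<open>J\<close>.\<close>
  have P2: "path_edges (a # ?P2 @ [c]) = path_edges (c # xs @ d # ys @ [a])"
    using path_edges_rev[of "c # xs @ d # ys @ [a]"] by simp
  have Q2: "path_edges (b # ?Q2 @ [d]) = path_edges (d # ys @ a # us @ [b])"
    using path_edges_rev[of "d # ys @ a # us @ [b]"] by simp
  define J where "J = path_image c1 \<union> path_image c2"
  have J: "J = path_image d1 \<union> path_image d2"
    unfolding J_def c d path_drawing_def P2 Q2 UN_Un[symmetric]
    using path_edges_append[of "a # us" b "ws @ [c]"] path_edges_append[of "c # xs" d "ys @ [a]"]
      path_edges_append[of "b # ws" c "xs @ [d]"] path_edges_append[of "d # ys" a "us @ [b]"]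
    by (intro arg_cong[where f = "\<lambda>S. \<Union>e\<in>S. path_image (\<gamma> e)"]) (simp add: Un_ac)
  define D where "D = path_image f - {p b, p d}"
  define X where "X = path_image e - {p a, p c}"
  have f: "arc f" "pathstart f = p b" "pathfinish f = p d"
    using d(1) by (auto simp: theta_arcs_def)
  have ne: "b \<noteq> a" "c \<noteq> a" "d \<noteq> a" "c \<noteq> b" "d \<noteq> b" "d \<noteq> c" using dist by auto
  note fs = arc_imp_simple_path[OF f(1)]
  have e: "arc e" "pathstart e = p a" "pathfinish e = p c"
    using c(1) by (auto simp: theta_arcs_def)
  have E: "path_edges xs \<subseteq> E" if "successively adj xs" for xs
    using that by (rule path_edges_subset_edges)
  have "F \<inter> (path_image c1 \<union> path_image c2 \<union> path_image e) = {}"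
    unfolding c using P ac by (simp add: Int_Un_distrib path_drawing_disjoint_face E)
  moreover have "p b \<in> closure F" "p b \<in> path_image c1 - {p a, p c}" "p d \<in> closure F" "p d \<in> path_image c2 - {p a, p c}"
    unfolding c using interior_vertex_touches[of b ?P1 a c] interior_vertex_touches[of d ?P2 a c] dist V P ne
    by (simp_all add: Int_Un_distrib Int_commute)
  ultimately have 1: "F \<subseteq> inside J \<and> X \<subseteq> outside J \<or>
      F \<subseteq> outside J \<and> X \<subseteq> inside J"
    unfolding J_def X_def by (rule theta_opposite_sides[OF c(1) connected_face])
  have "F \<inter> (path_image d1 \<union> path_image d2 \<union> path_image f) = {}"
    unfolding d using Q bd by (simp add: Int_Un_distrib path_drawing_disjoint_face E)
  moreover have "p c \<in> closure F" "p c \<in> path_image d1 - {p b, p d}" "p a \<in> closure F" "p a \<in> path_image d2 - {p b, p d}"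
    unfolding d using interior_vertex_touches[of c ?Q1 b d] interior_vertex_touches[of a ?Q2 b d] dist V Q ne
    by (simp_all add: Int_Un_distrib Int_commute)
  ultimately have 2: "F \<subseteq> inside J \<and> D \<subseteq> outside J \<or> F \<subseteq> outside J \<and> D \<subseteq> inside J"
    unfolding J D_def by (rule theta_opposite_sides[OF d(1) connected_face])
  \<comment> \<open>From here \<open>D\<close> takes over the role of \<open>F\<close> in the theta
    curve with the chord from \<open>a\<close> to \<open>c\<close>.\<close>
  have conD: "connected D"
    using connected_simple_path_endless[OF fs] f unfolding D_def by simp
  have clD: "path_image f \<subseteq> closure D"
    using path_image_subset_closure_endless[OF fs] f unfolding D_def by simp
  have "path_drawing [a, c] \<inter> path_drawing [b, d] \<subseteq> p ` (set [a, c] \<inter> set [b, d])"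
    by (rule path_drawings_Int) (use ac bd dist in \<open>auto simp: doubleton_eq_iff\<close>)
  then have "D \<inter> path_image e = {}"
    unfolding D_def c d using dist by auto
  moreover have "D \<inter> J = {}"
    using d(1) unfolding D_def J theta_arcs_def by blast
  ultimately have "D \<inter> (path_image c1 \<union> path_image c2 \<union> path_image e) = {}"
    unfolding J_def by blast
  moreover have "p b \<in> closure D" "p d \<in> closure D"
    using clD f by (metis pathstart_in_path_image pathfinish_in_path_image subsetD)+
  ultimately have "D \<subseteq> inside J \<and> X \<subseteq> outside J \<or>
      D \<subseteq> outside J \<and> X \<subseteq> inside J"
    unfolding J_def X_def using \<open>p b \<in> path_image c1 - {p a, p c}\<close> \<open>p d \<in> path_image c2 - {p a, p c}\<close>
    by (intro theta_opposite_sides[OF c(1) conD])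
  moreover have "F \<noteq> {}" using \<open>p b \<in> closure F\<close> by auto
  moreover have "D \<noteq> {}" "X \<noteq> {}"
    using nonempty_simple_path_endless[OF fs] nonempty_simple_path_endless[OF arc_imp_simple_path[OF e(1)]] f e
    unfolding D_def X_def by auto
  ultimately show False
    using 1 2 inside_Int_outside[of J] by blast
qed

end

subsection \<open>Noncrossing vertex orders\<close>

text \<open>\<open>f\<close> gives the positions of the vertices on a circle that is cut open at one point.\<close>

definition noncrossing :: "'a set \<Rightarrow> ('a \<Rightarrow> 'a \<Rightarrow> bool) \<Rightarrow> ('a \<Rightarrow> nat) \<Rightarrow> bool" where
  "noncrossing W R f \<longleftrightarrow> inj_on f W \<and>
     (\<forall>a\<in>W. \<forall>b\<in>W. \<forall>c\<in>W. \<forall>d\<in>W. f a < f b \<longrightarrow> f b < f c \<longrightarrow> f c < f d \<longrightarrow> R a c \<longrightarrow> \<not> R b d)"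

lemma noncrossingD:
  "noncrossing W R f \<Longrightarrow> a \<in> W \<Longrightarrow> b \<in> W \<Longrightarrow> c \<in> W \<Longrightarrow> d \<in> W \<Longrightarrow>
    f a < f b \<Longrightarrow> f b < f c \<Longrightarrow> f c < f d \<Longrightarrow> R a c \<Longrightarrow> R b d \<Longrightarrow> False"
  unfolding noncrossing_def by blast

lemma noncrossing_inj: "noncrossing W R f \<Longrightarrow> x \<in> W \<Longrightarrow> y \<in> W \<Longrightarrow> f x = f y \<longleftrightarrow> x = y"
  unfolding noncrossing_def by (auto simp: inj_on_eq_iff)

lemma noncrossing_subset: "noncrossing W R f \<Longrightarrow> U \<subseteq> W \<Longrightarrow> noncrossing U R f"
  unfolding noncrossing_def by (meson inj_on_subset subsetD)

text \<open>Elements with position below \<open>t\<close> move behind all others. In a quadruple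
  listed in the new order, the moved elements form a final segment, so the old order is a cyclic
  shift of it; since \<open>R\<close> is symmetric, a cyclic shift of a crossing is a
  crossing.\<close>

lemma noncrossing_rotate:
  assumes nc: "noncrossing W R f" and sym: "\<And>x y. R x y \<Longrightarrow> R y x" and M: "\<And>x. x \<in> W \<Longrightarrow> f x < M"
  shows "noncrossing W R (\<lambda>x. if f x < t then f x + M else f x)" (is "noncrossing W R ?g")
  unfolding noncrossing_def
proof (intro conjI ballI impI notI)
  show "inj_on ?g W"
  proof (rule inj_onI)
    fix x y assume "x \<in> W" "y \<in> W" "?g x = ?g y"
    then show "x = y" using M[of x] M[of y] noncrossing_inj[OF nc, of x y] by (auto split: if_splits)
  qed
  fix a b c d assume W: "a \<in> W" "b \<in> W" "c \<in> W" "d \<in> W"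
    and lt: "?g a < ?g b" "?g b < ?g c" "?g c < ?g d" and R: "R a c" "R b d"
  note R' = R R[THEN sym]
  have key: "if f x < t then f y < t \<and> f x < f y else if f y < t then f y < f x else f x < f y"
    if "?g x < ?g y" "y \<in> W" for x y
    using that M[of y] by (auto split: if_splits)
  note keys = key[OF lt(1) W(2)] key[OF lt(2) W(3)] key[OF lt(3) W(4)] key[OF less_trans[OF less_trans[OF lt(1,2)] lt(3)] W(4)]
  consider "f a < t" | "\<not> f a < t" "f b < t" | "\<not> f b < t" "f c < t" | "\<not> f c < t" "f d < t" | "\<not> f d < t"
    by blast
  then show False
  proof cases
    case 1
    then have "f a < f b" "f b < f c" "f c < f d" using keys by (simp_all split: if_splits)
    then show False using noncrossingD[OF nc W] R' by blast
  next
    case 2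
    then have "f b < f c" "f c < f d" "f d < f a" using keys by (simp_all split: if_splits)
    then show False using noncrossingD[OF nc W(2,3,4,1)] R' by blast
  next
    case 3
    then have "f c < f d" "f d < f a" "f a < f b" using keys by (simp_all split: if_splits)
    then show False using noncrossingD[OF nc W(3,4,1,2)] R' by blast
  next
    case 4
    then have "f d < f a" "f a < f b" "f b < f c" using keys by (simp_all split: if_splits)
    then show False using noncrossingD[OF nc W(4,1,2,3)] R' by blast
  next
    case 5
    then have "f a < f b" "f b < f c" "f c < f d" using keys by (simp_all split: if_splits)
    then show False using noncrossingD[OF nc W] R' by blast
  qed
qed

lemma noncrossing_rotate_first:
  assumes nc: "noncrossing W R f" and sym: "\<And>x y. R x y \<Longrightarrow> R y x" and "finite W"
  obtains g where "noncrossing W R g" "\<And>x. x \<in> W \<Longrightarrow> g c \<le> g x"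
proof -
  define M where "M = Suc (\<Sum>x\<in>insert c W. f x)"
  have M: "f x < M" if "x \<in> insert c W" for x
    unfolding M_def using that \<open>finite W\<close> by (simp add: less_Suc_eq_le member_le_sum del: sum.insert_if)
  show ?thesis
    by (rule that[OF noncrossing_rotate[OF nc sym M, of "f c"]]) (use M[of c] in auto)
qed

lemma noncrossing_rotate_last:
  assumes nc: "noncrossing W R f" and sym: "\<And>x y. R x y \<Longrightarrow> R y x" and "finite W"
  obtains g where "noncrossing W R g" "\<And>x. x \<in> W \<Longrightarrow> g x \<le> g c"
proof -
  define M where "M = Suc (\<Sum>x\<in>insert c W. f x)"
  have M: "f x < M" if "x \<in> insert c W" for x
    unfolding M_def using that \<open>finite W\<close> by (simp add: less_Suc_eq_le member_le_sum del: sum.insert_if)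
  \<comment> \<open>The threshold \<open>Suc (f c)\<close> moves \<open>c\<close> as well, so that
    it comes last instead of first.\<close>
  show ?thesis
    by (rule that[OF noncrossing_rotate[OF nc sym M, of "Suc (f c)"]])
      (auto, use M in fastforce)
qed

text \<open>With \<open>c\<close> turned to the end of one order and to the start of the other, the
  orders are concatenated at \<open>c\<close>. Every edge stays within one part, and the parts meet
  only in \<open>c\<close>, so crossing edges would already cross in one of the given
  orders.\<close>

lemma noncrossing_glue:
  assumes f1: "noncrossing (insert c A) R f1" and f2: "noncrossing (insert c B) R f2"
    and fin: "finite A" "finite B" and disj: "A \<inter> B = {}" "c \<notin> A" "c \<notin> B"
    and sym: "\<And>x y. R x y \<Longrightarrow> R y x"
    and sep: "\<And>x y. x \<in> A \<Longrightarrow> y \<in> B \<Longrightarrow> \<not> R x y"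
  shows "\<exists>f. noncrossing (insert c (A \<union> B)) R f"
proof -
  obtain g1 where g1: "noncrossing (insert c A) R g1" and le1: "\<And>x. x \<in> insert c A \<Longrightarrow> g1 x \<le> g1 c"
    using noncrossing_rotate_last[OF f1 sym, of c] fin by auto
  obtain g2 where g2: "noncrossing (insert c B) R g2" and le2: "\<And>x. x \<in> insert c B \<Longrightarrow> g2 c \<le> g2 x"
    using noncrossing_rotate_first[OF f2 sym, of c] fin by auto
  define h where "h x = (if x \<in> B then g1 c + 1 + g2 x else g1 x)" for x
  have hA: "h x = g1 x" if "x \<in> insert c A" for x using that disj by (auto simp: h_def)
  have hB: "h x = g1 c + 1 + g2 x" if "x \<in> B" for x using that by (simp add: h_def)
  have lt: "h x < h y" if "x \<in> insert c A" "y \<in> B" for x y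
    using that hA[of x] hB[of y] le1[of x] by auto
  have mono: "g2 x < g2 y" if "x \<in> insert c B" "y \<in> insert c B" "h x < h y" for x y
  proof -
    have "g2 c < g2 z" if "z \<in> B" for z
      using le2[of z] noncrossing_inj[OF g2, of c z] that disj by (metis insertCI le_neq_implies_less)
    then show ?thesis using that hA[of c] hB[of x] hB[of y] by auto
  qed
  have "noncrossing (insert c (A \<union> B)) R h"
    unfolding noncrossing_def
  proof (intro conjI ballI impI notI)
    show "inj_on h (insert c (A \<union> B))"
    proof (rule inj_onI)
      fix x y assume xy: "x \<in> insert c (A \<union> B)" "y \<in> insert c (A \<union> B)" "h x = h y"
      show "x = y"
      proof (cases "x \<in> B")
        case True
        then have "y \<in> B" using lt[of y x] xy by force
        then have "g2 x = g2 y" using hB[OF True] hB[of y] xy(3) by linarith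
        then show ?thesis using noncrossing_inj[OF g2, of x y] True \<open>y \<in> B\<close> by blast
      next
        case False
        then have x: "x \<in> insert c A" using xy by blast
        then have y: "y \<in> insert c A" using lt[of x y] xy by force
        show ?thesis using noncrossing_inj[OF g1 x y] hA[OF x] hA[OF y] xy(3) by argo
      qed
    qed
    fix u v w z assume W: "u \<in> insert c (A \<union> B)" "v \<in> insert c (A \<union> B)" "w \<in> insert c (A \<union> B)" "z \<in> insert c (A \<union> B)"
      and ord: "h u < h v" "h v < h w" "h w < h z" and R: "R u w" "R v z"
    have side: "x \<in> insert c A \<and> y \<in> insert c A \<or> x \<in> insert c B \<and> y \<in> insert c B"
      if "R x y" "x \<in> insert c (A \<union> B)" "y \<in> insert c (A \<union> B)" for x y
      using that sep sym by blast
    have A_down: "x \<in> A" if "h x < h y" "x \<in> insert c (A \<union> B)" "y \<in> insert c A" for x y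
      using that lt[of y x] hA[of y] le1[of y] hA[of c] by (metis Un_iff insert_iff less_asym not_le)
    show False
    proof (cases "w \<in> insert c A")
      case True
      then have "v \<in> A" "u \<in> A" using A_down W ord by (blast, meson A_down W less_trans ord)
      moreover from this have "z \<in> insert c A" using side[OF R(2)] W disj by auto
      ultimately show False
        using noncrossingD[OF g1, of u v w z] True ord R hA by auto
    next
      case False
      then have "u \<in> insert c B" "w \<in> B" "z \<in> B"
        using W side[OF R(1)] A_down[OF ord(3)] by auto
      moreover from this have "v \<in> insert c B"
        using A_down[OF ord(1)] W disj hA[of c] by (metis Un_iff insert_iff disjoint_iff)
      ultimately show False
        using noncrossingD[OF g2, of u v w z] mono ord R by auto
    qed
  qed
  then show ?thesis by blast
qed

section \<open>Longest cycles and decomposition at cut vertices\<close>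

text \<open>The two forbidden configurations carry the information taken from the drawing; both
  speak of lists of vertices in \<open>V\<close> and hence pass to every subset.\<close>

locale outer_graph =
  fixes V :: "'a set" and R :: "'a \<Rightarrow> 'a \<Rightarrow> bool"
  assumes finite_V: "finite V" and sym: "R x y \<Longrightarrow> R y x" and irrefl: "\<not> R x x"
    and no_theta: "us \<noteq> [] \<Longrightarrow> ws \<noteq> [] \<Longrightarrow> zs \<noteq> [] \<Longrightarrow> distinct (a # us @ ws @ zs @ [b]) \<Longrightarrow>
      set (a # us @ ws @ zs @ [b]) \<subseteq> V \<Longrightarrow> successively R (a # us @ [b]) \<Longrightarrow>
      successively R (a # ws @ [b]) \<Longrightarrow> successively R (a # zs @ [b]) \<Longrightarrow> False"
    and no_crossing_chords: "distinct (a # us @ b # ws @ c # xs @ d # ys) \<Longrightarrow>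
      set (a # us @ b # ws @ c # xs @ d # ys) \<subseteq> V \<Longrightarrow>
      successively R (a # us @ b # ws @ c # xs @ d # ys @ [a]) \<Longrightarrow> R a c \<Longrightarrow> R b d \<Longrightarrow> False"
begin

definition cyclic :: "'a list \<Rightarrow> bool" where
  "cyclic C \<longleftrightarrow> distinct C \<and> length C \<ge> 2 \<and> successively R C \<and> R (last C) (hd C)"

lemma successively_rev_sym: "successively R (rev xs) \<longleftrightarrow> successively R xs"
proof -
  have "(\<lambda>x y. R y x) = R" using sym by (intro ext) blast
  then show ?thesis by (metis successively_rev)
qed

lemma cyclic_rotate:
  assumes "cyclic (X @ a # Y)"
  shows "successively R (a # Y @ X @ [a])"
proof -
  have "successively R ((a # Y) @ (X @ [a]))"
  proof (cases X)
    case Nil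
    then show ?thesis using assms unfolding cyclic_def by (simp only: successively_append_iff) simp
  next
    case (Cons x X')
    then have "successively R X" "successively R (a # Y)" "R (last X) a" "R (last (a # Y)) (hd X)"
      using assms unfolding cyclic_def by (simp_all only: successively_append_iff) simp_all
    then show ?thesis using Cons by (simp only: successively_append_iff) simp
  qed
  then show ?thesis by simp
qed

lemma successively_middle: "successively R (xs @ ys @ zs) \<Longrightarrow> successively R ys"
  by (simp add: successively_append_iff)

text \<open>Positions along the cycle serve as the order, in which crossing edges are crossing
  chords of the cycle.\<close>

lemma Hamiltonian_noncrossing:
  assumes C: "cyclic C" and V: "set C \<subseteq> V"
  shows "\<exists>f. noncrossing (set C) R f"
proof -
  define f where "f = the_inv_into {..<length C} ((!) C)"
  have inj: "inj_on ((!) C) {..<length C}"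
    using C by (auto simp: cyclic_def inj_on_nth)
  have img: "(!) C ` {..<length C} = set C" by (auto simp: set_conv_nth)
  have f: "f x < length C" "C ! f x = x" if "x \<in> set C" for x
    using the_inv_into_into[OF inj, of x] f_the_inv_into_f[OF inj, of x] that img by (auto simp: f_def)
  have "inj_on f (set C)" using f by (metis inj_onI)
  moreover have False
    if abcd: "a \<in> set C" "b \<in> set C" "c \<in> set C" "d \<in> set C" "f a < f b" "f b < f c" "f c < f d" and R: "R a c" "R b d"
    for a b c d
  proof -
    have split: "\<exists>X Y. xs = X @ xs ! i # Y \<and> length X = i" if "i < length xs" for xs :: "'a list" and i
      using id_take_nth_drop[OF that] that by (intro exI[of _ "take i xs"] exI[of _ "drop (Suc i) xs"]) simp
    \<comment> \<open>Splitting at the last position first keeps the other positions valid, since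
      what is left is a prefix.\<close>
    obtain C3 T where C3: "C = C3 @ d # T" "length C3 = f d" using split[of "f d" C] f abcd(4) by metis
    have "C3 ! f c = c" using f(2)[OF abcd(3)] C3 abcd(7) by (simp add: nth_append)
    then obtain C2 S where C2: "C3 = C2 @ c # S" "length C2 = f c" using split[of "f c" C3] C3 abcd(7) by metis
    have "C2 ! f b = b" using f(2)[OF abcd(2)] C3 C2 abcd(6,7) by (simp add: nth_append)
    then obtain C1 Q where C1: "C2 = C1 @ b # Q" "length C1 = f b" using split[of "f b" C2] C2 abcd(6) by metis
    have "C1 ! f a = a" using f(2)[OF abcd(1)] C3 C2 C1 abcd(5,6,7) by (simp add: nth_append)
    then obtain X P where "C1 = X @ a # P" using split[of "f a" C1] C1 abcd(5) by metis
    then have eq: "C = X @ a # P @ b # Q @ c # S @ d # T" using C1 C2 C3 by simp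
    have "successively R (a # P @ b # Q @ c # S @ d # (T @ X) @ [a])"
      using cyclic_rotate[of X a "P @ b # Q @ c # S @ d # T"] C unfolding eq by simp
    moreover have "distinct (a # P @ b # Q @ c # S @ d # (T @ X))"
      using C unfolding eq cyclic_def by auto
    ultimately show False
      using no_crossing_chords[of a P b Q c S d "T @ X"] R V unfolding eq by auto
  qed
  ultimately show ?thesis unfolding noncrossing_def by blast
qed

text \<open>\<open>P\<close> is an ear attached to the cycle at \<open>a\<close> and
  \<open>b\<close>. If both arcs of the cycle between \<open>a\<close> and \<open>b\<close> had
  inner vertices, they would form a forbidden theta with \<open>P\<close>. So \<open>a\<close> and
  \<open>b\<close> are consecutive, and \<open>P\<close> replaces the edge between them without loss
  of a vertex.\<close>

lemma cyclic_extend: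
  assumes C: "cyclic (X @ a # us @ b # S)" and P: "P \<noteq> []" "distinct P" "successively R P"
    and disj: "set P \<inter> set (X @ a # us @ b # S) = {}" and V: "set P \<union> set (X @ a # us @ b # S) \<subseteq> V"
    and ends: "R a (hd P)" "R (last P) b"
  shows "\<exists>C'. cyclic C' \<and> set C' = set P \<union> set (X @ a # us @ b # S)"
proof -
  consider "us = []" | "S @ X = []" | "us \<noteq> []" "S @ X \<noteq> []" by blast
  then show ?thesis
  proof cases
    case 1
    have "successively R (a # P @ [b])"
      using P ends by (simp add: successively_append_iff successively_Cons)
    moreover have "successively R (X @ [a])" "successively R (b # S)"
      using C successively_middle[of "[]" "X @ [a]" "b # S"] successively_middle[of "X @ [a]" "b # S" "[]"]
      unfolding 1 cyclic_def by simp_all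
    ultimately have "successively R (X @ a # P @ b # S)"
      using P(1) by (cases S) (simp_all add: successively_append_iff successively_Cons)
    moreover have "distinct (X @ a # P @ b # S)"
      using C P(2) disj unfolding 1 cyclic_def by auto
    moreover have "R (last (X @ a # P @ b # S)) (hd (X @ a # P @ b # S))"
      using C unfolding 1 cyclic_def by (cases X) auto
    ultimately have "cyclic (X @ a # P @ b # S)"
      unfolding cyclic_def by simp
    then show ?thesis using 1 by (intro exI[of _ "X @ a # P @ b # S"]) auto
  next
    case 2
    then have "successively R (a # us @ [b])" using C unfolding cyclic_def by simp
    moreover have "successively R (rev P)" "R b (hd (rev P))" "R (last (rev P)) a"
      using P ends sym by (simp_all add: successively_rev_sym hd_rev last_rev del: successively_rev)
    ultimately have "successively R ((a # us @ [b]) @ rev P)"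
      by (simp only: successively_append_iff) simp
    then have "cyclic (a # us @ b # rev P)"
      using C P disj 2 \<open>R (last (rev P)) a\<close> unfolding cyclic_def by auto
    then show ?thesis using 2 by (intro exI[of _ "a # us @ b # rev P"]) auto
  next
    case 3
    have "successively R (b # (S @ X) @ [a])"
      using cyclic_rotate[of X a "us @ b # S"] C
        successively_middle[of "a # us" "b # (S @ X) @ [a]" "[]"] by simp
    then have "successively R (a # rev (S @ X) @ [b])"
      using successively_rev_sym[of "b # (S @ X) @ [a]"] by simp
    moreover have "successively R (a # us @ [b])"
      using C successively_middle[of X "a # us @ [b]" S] unfolding cyclic_def by simp
    moreover have "successively R (a # P @ [b])"
      using P ends by (simp add: successively_append_iff successively_Cons)
    moreover have "distinct (a # us @ P @ rev (S @ X) @ [b])"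
      using P(2) disj C unfolding cyclic_def by auto
    ultimately have False
      using no_theta[of us P "rev (S @ X)" a b] 3 P(1) V by auto
    then show ?thesis ..
  qed
qed

text \<open>For sets with at least three elements this also expresses connectedness.\<close>

definition biconnected :: "'a set \<Rightarrow> bool" where
  "biconnected W \<longleftrightarrow> (\<forall>c\<in>W. \<forall>A B. A \<union> B = W - {c} \<longrightarrow> A \<inter> B = {} \<longrightarrow> A \<noteq> {} \<longrightarrow> B \<noteq> {} \<longrightarrow> (\<exists>x\<in>A. \<exists>y\<in>B. R x y))"

text \<open>Deleting one vertex of the cycle yields an edge from some \<open>c\<close> on it to a
  vertex \<open>x\<close> off it; deleting \<open>c\<close> forces the region reached from
  \<open>x\<close> to return to the cycle at some \<open>y\<close> other than \<open>c\<close>. The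
  path obtained is an ear for \<open>cyclic_extend\<close>.\<close>

lemma biconnected_cyclic_extend:
  assumes W: "W \<subseteq> V" "biconnected W" and C: "cyclic C" "set C \<subset> W"
  shows "\<exists>C'. cyclic C' \<and> set C' \<subseteq> W \<and> card (set C) < card (set C')"
proof -
  have edge: "\<exists>x\<in>A. \<exists>y\<in>W - {c} - A. R x y" if "c \<in> W" "A \<subseteq> W - {c}" "A \<noteq> {}" "W - {c} - A \<noteq> {}" for c A
  proof -
    have "A \<union> (W - {c} - A) = W - {c}" "A \<inter> (W - {c} - A) = {}" using that by auto
    then show ?thesis using W(2) that unfolding biconnected_def by blast
  qed
  obtain c0 c1 where c01: "c0 \<in> set C" "c1 \<in> set C" "c0 \<noteq> c1"
  proof -
    have "2 \<le> card (set C)" using C(1) by (simp add: cyclic_def distinct_card)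
    then obtain c0 where "c0 \<in> set C" by fastforce
    moreover have "card (set C - {c0}) \<noteq> 0" using \<open>2 \<le> card (set C)\<close> calculation by simp
    ultimately show ?thesis using that by (metis DiffE card.empty equals0I insertI1)
  qed
  obtain c x where cx: "c \<in> set C" "x \<in> W" "x \<notin> set C" "R c x"
    using edge[of c0 "set C - {c0}"] c01 C(2) by blast
  define good where "good P \<longleftrightarrow> P \<noteq> [] \<and> hd P = x \<and> distinct P \<and> successively R P \<and> set P \<subseteq> W - set C" for P
  \<comment> \<open>\<open>Q\<close> consists of the vertices reached from \<open>x\<close> by paths
    off the cycle; an edge leaving \<open>Q\<close> within \<open>W - {c}\<close> can only end on
    the cycle.\<close>
  define Q where "Q = {r. \<exists>P. good P \<and> last P = r}"
  have "good [x]" using cx by (simp add: good_def)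
  then have "x \<in> Q" unfolding Q_def by fastforce
  moreover have QW: "Q \<subseteq> W - set C" unfolding Q_def good_def using last_in_set by blast
  moreover have "\<exists>c'\<in>set C. c' \<noteq> c" using c01 by metis
  ultimately obtain r y where ry: "r \<in> Q" "y \<in> W" "y \<noteq> c" "y \<notin> Q" "R r y"
    using edge[of c Q] cx C(2) by blast
  obtain P where P: "good P" "last P = r" using ry(1) unfolding Q_def by blast
  have y: "y \<in> set C"
  proof (rule ccontr)
    assume nC: "y \<notin> set C"
    show False
    proof (cases "y \<in> set P")
      case True
      then obtain P1 P2 where "P = P1 @ y # P2" by (meson split_list)
      then have "good (P1 @ [y])"
        using P(1) unfolding good_def by (auto simp: successively_append_iff hd_append split: if_splits)
      then have "y \<in> Q" unfolding Q_def by fastforce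
      then show False using ry by blast
    next
      case False
      then have "good (P @ [y])"
        using P ry nC unfolding good_def by (auto simp: successively_append_iff)
      then have "y \<in> Q" unfolding Q_def by fastforce
      then show False using ry by blast
    qed
  qed
  have P': "P \<noteq> []" "distinct P" "successively R P" "set P \<subseteq> W - set C" "R c (hd P)" "R (last P) y"
    using P cx ry unfolding good_def by auto
  have "\<exists>C'. cyclic C' \<and> set C' = set P \<union> set C"
  proof -
    obtain X S where CX: "C = X @ c # S" using cx by (meson split_list)
    show ?thesis
    proof (cases "y \<in> set S")
      case True
      then obtain us T where S: "S = us @ y # T" by (meson split_list)
      show ?thesis
        using cyclic_extend[of X c us y T P] C P' W(1) unfolding CX S by auto
    next
      case False
      then have "y \<in> set X" using y ry CX by auto
      then obtain Y us where X: "X = Y @ y # us" by (meson split_list)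
      have "successively R (rev P)" "R y (hd (rev P))" "R (last (rev P)) c"
        using P' sym by (auto simp: successively_rev_sym hd_rev last_rev simp del: successively_rev)
      then show ?thesis
        using cyclic_extend[of Y y us c S "rev P"] C P' W(1) unfolding CX X by auto
    qed
  qed
  then obtain C' where C': "cyclic C'" "set C' = set P \<union> set C" by blast
  moreover have "set C \<subset> set C'"
    using P' C' by (cases P) auto
  ultimately show ?thesis
    using P'(4) C(2) psubset_card_mono[of "set C'" "set C"] by (intro exI[of _ C']) auto
qed

lemma biconnected_Hamiltonian:
  assumes W: "W \<subseteq> V" "biconnected W" "card W \<ge> 3"
  shows "\<exists>C. cyclic C \<and> set C = W"
proof -
  have fin: "finite W" using W finite_V finite_subset by blast
  have "\<exists>C. cyclic C \<and> set C \<subseteq> W"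
  proof -
    obtain c where c: "c \<in> W" using W(3) by fastforce
    then have "card (W - {c}) \<ge> 2" using W(3) by simp
    then have "W - {c} \<noteq> {}" by force
    then obtain d where d: "d \<in> W - {c}" by blast
    have "card (W - {c} - {d}) \<ge> 1" using d \<open>card (W - {c}) \<ge> 2\<close> by simp
    then have "W - {c} - {d} \<noteq> {}" by fastforce
    moreover have "{d} \<union> (W - {c} - {d}) = W - {c}" using d by auto
    ultimately have "\<exists>x\<in>{d}. \<exists>y\<in>W - {c} - {d}. R x y"
      using W(2) c unfolding biconnected_def by blast
    then obtain y where "y \<in> W" "R d y" by blast
    then have "cyclic [d, y]" using sym irrefl by (auto simp: cyclic_def)
    then show ?thesis using d \<open>y \<in> W\<close> by (intro exI[of _ "[d, y]"]) auto
  qed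
  then obtain C0 where C0: "cyclic C0 \<and> set C0 \<subseteq> W" by blast
  have "\<exists>C. (cyclic C \<and> set C \<subseteq> W) \<and> (\<forall>C'. cyclic C' \<and> set C' \<subseteq> W \<longrightarrow> card (set C') \<le> card (set C))"
    by (rule ex_has_greatest_nat[of "\<lambda>C. cyclic C \<and> set C \<subseteq> W" C0 "\<lambda>C. card (set C)" "Suc (card W)"])
      (use C0 fin in \<open>auto simp: less_Suc_eq_le card_mono\<close>)
  then obtain C where C: "cyclic C" "set C \<subseteq> W"
    and max: "\<And>C'. cyclic C' \<Longrightarrow> set C' \<subseteq> W \<Longrightarrow> card (set C') \<le> card (set C)"
    by blast
  have "set C = W"
    using biconnected_cyclic_extend[OF W(1,2) C(1)] C(2) max by (metis leD psubsetI)
  then show ?thesis using C by blast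
qed

text \<open>The induction runs over all subsets of \<open>V\<close>, as splitting at
  \<open>c\<close> leaves two smaller sets that share \<open>c\<close>. With fewer than three
  vertices no crossing is possible, so any injection serves.\<close>

theorem outer_graph_noncrossing: "\<exists>f. noncrossing V R f"
proof -
  have "\<exists>f. noncrossing W R f" if "W \<subseteq> V" for W
    using that
  proof (induction "card W" arbitrary: W rule: less_induct)
    case less
    have fin: "finite W" using less.prems finite_V finite_subset by blast
    consider "card W < 3" | "card W \<ge> 3" "biconnected W" | "\<not> biconnected W" by linarith
    then show ?case
    proof cases
      case 1
      obtain f :: "'a \<Rightarrow> nat" where "inj_on f W"
        using finite_imp_inj_to_nat_seg[OF fin] by blast
      moreover have False if "a \<in> W" "b \<in> W" "c \<in> W" "f a < f b" "f b < f c" for a b c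
      proof -
        have "a \<noteq> b" "b \<noteq> c" "a \<noteq> c" using that by auto
        then have "card {a, b, c} = 3" by simp
        moreover have "card {a, b, c} \<le> card W" using that fin by (intro card_mono) auto
        ultimately show False using 1 by simp
      qed
      ultimately have "noncrossing W R f" unfolding noncrossing_def by blast
      then show ?thesis by blast
    next
      case 2
      then show ?thesis
        using biconnected_Hamiltonian[OF less.prems] Hamiltonian_noncrossing less.prems by blast
    next
      case 3
      then obtain c A B where c: "c \<in> W" "A \<union> B = W - {c}" "A \<inter> B = {}" "A \<noteq> {}" "B \<noteq> {}"
        "\<And>x y. x \<in> A \<Longrightarrow> y \<in> B \<Longrightarrow> \<not> R x y"
        unfolding biconnected_def by blast
      have W: "W = insert c (A \<union> B)" "c \<notin> A" "c \<notin> B" using c by auto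
      have "insert c A \<subset> W" "insert c B \<subset> W" using c W by blast+
      then have "\<exists>f. noncrossing (insert c A) R f" "\<exists>f. noncrossing (insert c B) R f"
        using less fin by (meson psubset_card_mono psubset_imp_subset subset_trans)+
      then show ?thesis
        using noncrossing_glue[of c A R _ B] c W sym fin by (metis finite_Un finite_insert)
    qed
  qed
  then show ?thesis by blast
qed

end

subsection \<open>Branch sets with at most two vertices\<close>

text \<open>\<open>R\<close> is adjacency in the graph whose complement should contain the minor, and \<open>x = y\<close> is allowed.\<close>

definition pair_model :: "'a set \<Rightarrow> ('a \<Rightarrow> 'a \<Rightarrow> bool) \<Rightarrow> 'a set set \<Rightarrow> bool" where
  "pair_model V R M \<longleftrightarrow> (\<forall>B\<in>M. \<exists>x\<in>V. \<exists>y\<in>V. B = {x, y} \<and> \<not> R x y) \<and>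
     (\<forall>B\<in>M. \<forall>C\<in>M. B \<noteq> C \<longrightarrow> B \<inter> C = {} \<and> (\<exists>x\<in>B. \<exists>y\<in>C. \<not> R x y))"

lemma pair_modelE:
  assumes "pair_model V R M" "B \<in> M"
  obtains x y where "x \<in> V" "y \<in> V" "B = {x, y}" "\<not> R x y"
proof -
  have "\<exists>x\<in>V. \<exists>y\<in>V. B = {x, y} \<and> \<not> R x y"
    using assms(1)[unfolded pair_model_def, THEN conjunct1] assms(2) by (rule bspec)
  then show ?thesis using that by (elim bexE conjE)
qed

lemma pair_modelD:
  assumes "pair_model V R M" "B \<in> M" "C \<in> M" "B \<noteq> C"
  shows "B \<inter> C = {}" "\<exists>x\<in>B. \<exists>y\<in>C. \<not> R x y"
  using assms(1)[unfolded pair_model_def, THEN conjunct2, THEN bspec[OF _ assms(2)], THEN bspec[OF _ assms(3)]] assms(4)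
  by simp_all

lemma pair_model_block_subset: "pair_model V R M \<Longrightarrow> B \<in> M \<Longrightarrow> B \<subseteq> V \<and> B \<noteq> {}"
  by (erule pair_modelE) auto

text \<open>Serves two purposes: to restore discarded vertices, and to pass from adjacency in
  \<open>G\<close> to nonadjacency in the complement.\<close>

lemma pair_model_mono:
  assumes M: "pair_model U R M" and "U \<subseteq> V" and RS: "\<And>x y. x \<in> U \<Longrightarrow> y \<in> U \<Longrightarrow> S x y \<Longrightarrow> R x y"
  shows "pair_model V S M"
  unfolding pair_model_def
proof (intro conjI ballI impI)
  fix B assume "B \<in> M"
  then obtain x y where "x \<in> U" "y \<in> U" "B = {x, y}" "\<not> R x y" using M by (elim pair_modelE)
  then show "\<exists>x\<in>V. \<exists>y\<in>V. B = {x, y} \<and> \<not> S x y"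
    using assms(2) RS[of x y] by (intro bexI[of _ x] bexI[of _ y]) auto
next
  fix B C assume BC: "B \<in> M" "C \<in> M" "B \<noteq> C"
  show "B \<inter> C = {}" by (rule pair_modelD[OF M BC])
  obtain x y where "x \<in> B" "y \<in> C" "\<not> R x y" using pair_modelD(2)[OF M BC] by blast
  moreover from this have "x \<in> U" "y \<in> U" using pair_model_block_subset[OF M] BC by blast+
  ultimately show "\<exists>x\<in>B. \<exists>y\<in>C. \<not> S x y" using RS by blast
qed

lemma pair_model_finite:
  assumes "pair_model V R M" "finite V" shows "finite M"
  using pair_model_block_subset[OF assms(1)] assms(2) by (meson Pow_iff finite_Pow_iff finite_subset subsetI)

text \<open>Blocks found for numbered vertices, where they can be checked by calculation, are
  carried over to the given vertex set.\<close>

lemma pair_model_image: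
  assumes M: "pair_model U (\<lambda>i j. R (v i) (v j)) M" and v: "bij_betw v U V"
  shows "pair_model V R ((`) v ` M)" "card ((`) v ` M) = card M"
proof -
  have sub: "B \<subseteq> U" if "B \<in> M" for B using pair_model_block_subset[OF M that] by simp
  have inj: "inj_on v U" using v by (rule bij_betw_imp_inj_on)
  have "inj_on ((`) v) M"
    using inj sub by (meson inj_onI inj_on_image_eq_iff)
  then show "card ((`) v ` M) = card M" by (rule card_image)
  have vU: "v x \<in> V" if "x \<in> U" for x using v that by (auto simp: bij_betw_def)
  show "pair_model V R ((`) v ` M)"
    unfolding pair_model_def
  proof (intro conjI ballI impI)
    fix B assume "B \<in> (`) v ` M"
    then obtain B' where B': "B' \<in> M" "B = v ` B'" by blast
    obtain x y where "x \<in> U" "y \<in> U" "B' = {x, y}" "\<not> R (v x) (v y)"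
      by (rule pair_modelE[OF M B'(1)])
    then show "\<exists>x\<in>V. \<exists>y\<in>V. B = {x, y} \<and> \<not> R x y" using vU B'(2) by (intro bexI[of _ "v x"] bexI[of _ "v y"]) auto
  next
    fix B C assume "B \<in> (`) v ` M" "C \<in> (`) v ` M" "B \<noteq> C"
    then obtain B' C' where BC: "B' \<in> M" "C' \<in> M" "B' \<noteq> C'" "B = v ` B'" "C = v ` C'" by blast
    note * = pair_modelD[OF M BC(1-3)]
    show "B \<inter> C = {}"
      using inj_on_image_Int[OF inj sub[OF BC(1)] sub[OF BC(2)]] *(1) BC by simp
    show "\<exists>x\<in>B. \<exists>y\<in>C. \<not> R x y" using *(2) BC by blast
  qed
qed

text \<open>Every other vertex is nonadjacent to \<open>u\<close> or to \<open>v\<close>, so a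
  single vertex of a block suffices to join it to \<open>{u, v}\<close> in the complement.\<close>

lemma pair_model_insert:
  assumes M: "pair_model (V - {u, v}) R M" and uv: "u \<in> V" "v \<in> V" "\<not> R u v" and "finite V"
    and sym: "\<And>x y. R x y \<Longrightarrow> R y x"
    and far: "\<And>w. w \<in> V - {u, v} \<Longrightarrow> \<not> (R u w \<and> R w v)"
  shows "pair_model V R (insert {u, v} M)" "card (insert {u, v} M) = Suc (card M)"
proof -
  have sub: "B \<subseteq> V - {u, v} \<and> B \<noteq> {}" if "B \<in> M" for B
    using pair_model_block_subset[OF M that] .
  then have "{u, v} \<notin> M" by blast
  moreover have "finite M" using pair_model_finite[OF M] \<open>finite V\<close> by simp
  ultimately show "card (insert {u, v} M) = Suc (card M)" by simp
  have ok: "\<exists>x\<in>{u, v}. \<exists>y\<in>B. \<not> R x y" "\<exists>x\<in>B. \<exists>y\<in>{u, v}. \<not> R x y" if B: "B \<in> M" for B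
  proof -
    obtain w where "w \<in> B" using sub[OF B] by blast
    then have "\<not> (R u w \<and> R w v)" using far sub[OF B] by blast
    then show "\<exists>x\<in>{u, v}. \<exists>y\<in>B. \<not> R x y" "\<exists>x\<in>B. \<exists>y\<in>{u, v}. \<not> R x y"
      using \<open>w \<in> B\<close> sym by blast+
  qed
  show "pair_model V R (insert {u, v} M)"
    unfolding pair_model_def
  proof (intro conjI ballI impI)
    fix B assume "B \<in> insert {u, v} M"
    then consider "B = {u, v}" | "B \<in> M" by blast
    then show "\<exists>x\<in>V. \<exists>y\<in>V. B = {x, y} \<and> \<not> R x y"
    proof cases
      case 1
      show ?thesis by (intro bexI[of _ u] bexI[of _ v]) (use 1 uv in auto)
    next
      case 2
      then obtain x y where "x \<in> V - {u, v}" "y \<in> V - {u, v}" "B = {x, y}" "\<not> R x y"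
        using M by (elim pair_modelE)
      then show ?thesis by (intro bexI[of _ x] bexI[of _ y]) auto
    qed
  next
    fix B C assume BC: "B \<in> insert {u, v} M" "C \<in> insert {u, v} M" "B \<noteq> C"
    consider "B = {u, v}" "C \<in> M" | "B \<in> M" "C = {u, v}" | "B \<in> M" "C \<in> M" using BC by blast
    then have "B \<inter> C = {} \<and> (\<exists>x\<in>B. \<exists>y\<in>C. \<not> R x y)"
    proof cases
      case 1 then show ?thesis using sub[of C] ok[of C] by blast
    next
      case 2 then show ?thesis using sub[of B] ok[of B] by blast
    next
      case 3 then show ?thesis using pair_modelD[OF M] BC(3) by blast
    qed
    then show "B \<inter> C = {}" "\<exists>x\<in>B. \<exists>y\<in>C. \<not> R x y" by blast+
  qed
qed

text \<open>\<open>sorted_wrt\<close> compares every entry with all later ones, which for explicit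
  lists can be checked by rewriting. Disjointness of nonempty blocks also makes the number of blocks
  equal to the length of the list.\<close>

lemma pair_model_of_list:
  assumes inV: "\<And>x y. (x, y) \<in> set L \<Longrightarrow> x \<in> V \<and> y \<in> V \<and> \<not> R x y"
    and sym: "\<And>x y. R x y \<Longrightarrow> R y x"
    and sep: "sorted_wrt (\<lambda>s t. {fst s, snd s} \<inter> {fst t, snd t} = {} \<and>
      \<not> (\<forall>x\<in>{fst s, snd s}. \<forall>y\<in>{fst t, snd t}. R x y)) L"
  shows "\<exists>M. pair_model V R M \<and> card M = length L"
proof -
  define blk where "blk i = {fst (L ! i), snd (L ! i)}" for i
  have less: "blk i \<inter> blk j = {} \<and> (\<exists>s\<in>blk i. \<exists>t\<in>blk j. \<not> R s t)" if "i < j" "j < length L" for i j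
    using sorted_wrt_nth_less[OF sep that] unfolding blk_def by blast
  have sep': "blk i \<inter> blk j = {}" "\<exists>s\<in>blk i. \<exists>t\<in>blk j. \<not> R s t"
    if "i < length L" "j < length L" "i \<noteq> j" for i j
  proof -
    have "blk i \<inter> blk j = {} \<and> (\<exists>s\<in>blk i. \<exists>t\<in>blk j. \<not> R s t)"
    proof (cases "i < j")
      case False
      then have "blk j \<inter> blk i = {}" "\<exists>s\<in>blk j. \<exists>t\<in>blk i. \<not> R s t" using less[of j i] that by auto
      then show ?thesis using sym by blast
    qed (use less that in blast)
    then show "blk i \<inter> blk j = {}" "\<exists>s\<in>blk i. \<exists>t\<in>blk j. \<not> R s t" by simp_all
  qed
  have "blk i \<noteq> {}" for i by (simp add: blk_def)
  then have "inj_on blk {..<length L}"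
    using sep'(1) by (intro inj_onI) (metis Int_absorb lessThan_iff)
  then have "card (blk ` {..<length L}) = length L" by (simp add: card_image)
  moreover have "pair_model V R (blk ` {..<length L})"
    unfolding pair_model_def
  proof (intro conjI ballI impI)
    fix B assume "B \<in> blk ` {..<length L}"
    then obtain i where i: "i < length L" "B = blk i" by blast
    then have "(fst (L ! i), snd (L ! i)) \<in> set L" by simp
    then show "\<exists>x\<in>V. \<exists>y\<in>V. B = {x, y} \<and> \<not> R x y"
      using inV[of "fst (L ! i)" "snd (L ! i)"] i(2) unfolding blk_def by blast
  next
    fix B C assume "B \<in> blk ` {..<length L}" "C \<in> blk ` {..<length L}" "B \<noteq> C"
    then obtain i j where "i < length L" "j < length L" "i \<noteq> j" "B = blk i" "C = blk j" by blast
    then show "B \<inter> C = {}" "\<exists>x\<in>B. \<exists>y\<in>C. \<not> R x y" using sep' by simp_all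
  qed
  ultimately show ?thesis by blast
qed

lemma increasing_enumeration:
  fixes f :: "'a \<Rightarrow> nat"
  assumes "inj_on f V" "finite V"
  obtains v where "bij_betw v {..<card V} V" "\<And>i j. i < j \<Longrightarrow> j < card V \<Longrightarrow> f (v i) < f (v j)"
proof -
  define xs where "xs = sorted_list_of_set (f ` V)"
  define v where "v i = the_inv_into V f (xs ! i)" for i
  have len: "length xs = card V" using assms by (simp add: xs_def card_image)
  have xs: "xs ! i \<in> f ` V" if "i < card V" for i
    using that len assms(2) by (metis finite_imageI nth_mem set_sorted_list_of_set xs_def)
  have fv: "f (v i) = xs ! i" "v i \<in> V" if "i < card V" for i
    using f_the_inv_into_f[OF assms(1) xs[OF that]] the_inv_into_into[OF assms(1) xs[OF that]] by (auto simp: v_def)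
  have lt: "f (v i) < f (v j)" if "i < j" "j < card V" for i j
  proof -
    have "sorted_wrt (<) xs" by (simp add: xs_def)
    then show ?thesis using that fv len sorted_wrt_nth_less by fastforce
  qed
  have "inj_on v {..<card V}"
    by (rule inj_onI) (metis lessThan_iff less_irrefl lt nat_neq_iff)
  moreover have "v ` {..<card V} \<subseteq> V" using fv by auto
  ultimately have "bij_betw v {..<card V} V"
    using assms(2) by (metis bij_betw_def card_image card_lessThan card_subset_eq)
  then show ?thesis using lt that by blast
qed

subsection \<open>Eleven vertices\<close>

text \<open>The vertices are \<open>0, \<dots>, 10\<close> in a noncrossing order. A leaf of the decision tree lists seven
  branch sets \<open>{x, y}\<close> as pairs, with \<open>x = y\<close> for singletons; an inner node \<open>Branch i j s t\<close> continues
  with \<open>s\<close> if \<open>i\<close> and \<open>j\<close> are adjacent and with \<open>t\<close> otherwise. Along a path through the tree, \<open>ps\<close> and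
  \<open>ns\<close> collect the edges known to be present and absent.\<close>

datatype certificate = Cert "(nat \<times> nat) list" | Branch nat nat certificate certificate

definition crosses :: "nat \<Rightarrow> nat \<Rightarrow> nat \<Rightarrow> nat \<Rightarrow> bool" where
  "crosses i j k l \<longleftrightarrow>
     min i j < min k l \<and> min k l < max i j \<and> max i j < max k l \<or>
     min k l < min i j \<and> min i j < max k l \<and> max k l < max i j"

definition absent :: "(nat \<times> nat) list \<Rightarrow> (nat \<times> nat) list \<Rightarrow> nat \<Rightarrow> nat \<Rightarrow> bool" where
  "absent ps ns i j \<longleftrightarrow> i = j \<or> (i, j) \<in> set ns \<or> (j, i) \<in> set ns \<or> list_ex (\<lambda>(k, l). crosses i j k l) ps"

text \<open>The last two disjuncts apply because two of the four edges between the pairs would cross.\<close>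

definition separated :: "(nat \<times> nat) list \<Rightarrow> (nat \<times> nat) list \<Rightarrow> nat \<times> nat \<Rightarrow> nat \<times> nat \<Rightarrow> bool" where
  "separated ps ns = (\<lambda>(x, y) (z, w). x \<noteq> z \<and> x \<noteq> w \<and> y \<noteq> z \<and> y \<noteq> w \<and>
     (absent ps ns x z \<or> absent ps ns x w \<or> absent ps ns y z \<or> absent ps ns y w \<or>
      crosses x z y w \<or> crosses x w y z))"

fun valid :: "(nat \<times> nat) list \<Rightarrow> (nat \<times> nat) list \<Rightarrow> certificate \<Rightarrow> bool" where
  "valid ps ns (Cert L) \<longleftrightarrow> length L = 7 \<and>
     list_all (\<lambda>(x, y). x < 11 \<and> y < 11 \<and> absent ps ns x y) L \<and> sorted_wrt (separated ps ns) L"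
| "valid ps ns (Branch i j s t) \<longleftrightarrow> i < 11 \<and> j < 11 \<and> valid ((i, j) # ps) ns s \<and> valid ps ((i, j) # ns) t"

text \<open>Found by computer search, under the assumption that vertex \<open>0\<close> is adjacent at most to \<open>1\<close> and \<open>10\<close>.\<close>

definition cert11 :: certificate where "cert11 =
   (Branch 4 9 (Branch 4 10 (Branch 5 7 (Cert [(0, 0), (2, 2), (8, 8), (5, 10), (1, 7), (3, 9), (4, 6)])
    (Cert [(2, 2), (5, 5), (7, 7), (6, 10), (0, 4), (1, 8), (3, 9)])) (Branch 5 7 (Branch 2 10 (Cert
    [(0, 0), (3, 3), (8, 8), (5, 10), (1, 4), (2, 7), (6, 9)]) (Cert [(10, 10), (2, 2), (8, 8), (0, 4),
    (1, 5), (3, 7), (6, 9)])) (Branch 2 10 (Cert [(0, 0), (5, 5), (7, 7), (4, 10), (1, 9), (2, 6), (3,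
    8)]) (Cert [(2, 2), (5, 5), (7, 7), (4, 10), (0, 9), (1, 6), (3, 8)])))) (Branch 2 7 (Branch 2 10
   (Branch 3 5 (Cert [(0, 0), (6, 6), (8, 8), (3, 10), (1, 7), (2, 4), (5, 9)]) (Cert [(3, 3), (5, 5),
    (8, 8), (4, 10), (0, 2), (1, 7), (6, 9)])) (Branch 3 5 (Branch 8 10 (Cert [(0, 0), (4, 4), (6, 6),
    (2, 10), (1, 3), (5, 8), (7, 9)]) (Cert [(10, 10), (6, 6), (8, 8), (0, 2), (1, 3), (4, 7), (5, 9)]))
   (Branch 8 10 (Cert [(0, 0), (3, 3), (5, 5), (2, 10), (1, 4), (6, 8), (7, 9)]) (Cert [(3, 3), (5, 5),
    (8, 8), (2, 10), (0, 7), (1, 4), (6, 9)])))) (Branch 1 7 (Branch 3 7 (Cert [(0, 0), (4, 4), (8, 8),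
    (3, 10), (1, 5), (2, 7), (6, 9)]) (Branch 2 5 (Cert [(0, 0), (3, 3), (8, 8), (5, 10), (1, 4), (2,
    7), (6, 9)]) (Branch 3 5 (Cert [(0, 0), (2, 2), (8, 8), (5, 10), (1, 4), (3, 7), (6, 9)]) (Cert [(0,
    0), (2, 2), (5, 5), (8, 8), (4, 10), (3, 7), (6, 9)])))) (Branch 2 6 (Branch 1 6 (Branch 7 9 (Branch
    1 10 (Branch 6 10 (Branch 2 4 (Cert [(0, 0), (3, 3), (5, 5), (2, 10), (1, 7), (4, 9), (6, 8)]) (Cert
    [(0, 0), (2, 2), (4, 4), (3, 10), (1, 7), (5, 9), (6, 8)])) (Cert [(10, 10), (3, 3), (8, 8), (0, 6),
    (1, 4), (2, 7), (5, 9)])) (Cert [(10, 10), (1, 1), (3, 3), (0, 4), (2, 7), (5, 9), (6, 8)])) (Cert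
    [(3, 3), (7, 7), (9, 9), (2, 10), (0, 6), (1, 4), (5, 8)])) (Branch 1 9 (Cert [(10, 10), (3, 3), (7,
    7), (0, 2), (1, 6), (4, 8), (5, 9)]) (Branch 2 9 (Branch 1 10 (Branch 3 5 (Branch 2 10 (Branch 2 8
    (Cert [(0, 0), (3, 3), (9, 9), (4, 10), (1, 6), (2, 7), (5, 8)]) (Cert [(10, 10), (3, 3), (7, 7),
    (0, 4), (1, 6), (2, 8), (5, 9)])) (Cert [(10, 10), (3, 3), (7, 7), (0, 2), (1, 6), (4, 8), (5, 9)]))
    (Cert [(10, 10), (3, 3), (5, 5), (0, 6), (1, 8), (2, 7), (4, 9)])) (Cert [(10, 10), (1, 1), (3, 3),
    (0, 6), (2, 7), (4, 8), (5, 9)])) (Cert [(0, 0), (3, 3), (7, 7), (4, 10), (1, 6), (2, 9), (5,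
    8)])))) (Branch 1 6 (Branch 2 4 (Branch 1 9 (Cert [(10, 10), (3, 3), (5, 5), (0, 6), (1, 7), (2, 8),
    (4, 9)]) (Cert [(0, 0), (2, 2), (7, 7), (4, 10), (1, 9), (3, 6), (5, 8)])) (Branch 1 9 (Cert [(10,
    10), (2, 2), (4, 4), (0, 6), (1, 7), (3, 8), (5, 9)]) (Cert [(0, 0), (4, 4), (7, 7), (3, 10), (1,
    9), (2, 6), (5, 8)]))) (Branch 3 10 (Branch 5 9 (Cert [(0, 0), (2, 2), (6, 6), (7, 10), (1, 5), (3,
    8), (4, 9)]) (Branch 3 7 (Cert [(2, 2), (4, 4), (8, 8), (5, 10), (0, 3), (1, 7), (6, 9)]) (Branch 8
    10 (Branch 3 8 (Branch 3 5 (Cert [(0, 0), (2, 2), (4, 4), (5, 10), (1, 8), (3, 7), (6, 9)]) (Cert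
    [(0, 0), (2, 2), (5, 5), (4, 10), (1, 8), (3, 7), (6, 9)])) (Branch 5 7 (Branch 4 8 (Cert [(0, 0),
    (2, 2), (5, 5), (6, 10), (1, 4), (3, 8), (7, 9)]) (Cert [(0, 0), (2, 2), (4, 4), (6, 10), (1, 5),
    (3, 8), (7, 9)])) (Branch 5 8 (Cert [(0, 0), (2, 2), (4, 4), (6, 10), (1, 8), (3, 7), (5, 9)]) (Cert
    [(0, 0), (2, 2), (5, 5), (7, 7), (1, 4), (3, 8), (6, 9)])))) (Branch 5 8 (Cert [(0, 0), (2, 2), (4,
    4), (6, 10), (1, 8), (3, 7), (5, 9)]) (Branch 4 8 (Cert [(0, 0), (2, 2), (5, 5), (6, 10), (1, 8),
    (3, 7), (4, 9)]) (Branch 5 7 (Cert [(0, 0), (2, 2), (4, 4), (8, 10), (1, 7), (3, 6), (5, 9)])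
   (Branch 4 7 (Cert [(0, 0), (2, 2), (5, 5), (8, 10), (1, 4), (3, 7), (6, 9)]) (Cert [(0, 0), (2, 2),
    (4, 4), (8, 10), (1, 6), (3, 7), (5, 9)])))))))) (Branch 5 8 (Branch 4 8 (Branch 4 10 (Cert [(0, 0),
    (2, 2), (5, 5), (6, 10), (1, 7), (3, 8), (4, 9)]) (Branch 3 9 (Cert [(10, 10), (4, 4), (6, 6), (0,
    3), (1, 5), (2, 8), (7, 9)]) (Cert [(3, 3), (5, 5), (9, 9), (4, 10), (0, 8), (1, 6), (2, 7)])))
   (Branch 2 10 (Branch 3 9 (Cert [(10, 10), (4, 4), (6, 6), (0, 3), (1, 5), (2, 8), (7, 9)]) (Cert
    [(0, 0), (6, 6), (9, 9), (3, 10), (1, 5), (2, 7), (4, 8)])) (Branch 5 9 (Branch 6 8 (Branch 1 5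
    (Cert [(0, 0), (2, 2), (9, 9), (3, 10), (1, 6), (4, 8), (5, 7)]) (Branch 1 3 (Branch 5 10 (Cert [(0,
    0), (2, 2), (4, 4), (6, 10), (1, 8), (3, 9), (5, 7)]) (Cert [(10, 10), (2, 2), (6, 6), (0, 3), (1,
    5), (4, 8), (7, 9)])) (Branch 5 10 (Cert [(0, 0), (2, 2), (9, 9), (3, 10), (1, 6), (4, 8), (5, 7)])
    (Cert [(10, 10), (3, 3), (6, 6), (0, 2), (1, 5), (4, 8), (7, 9)])))) (Branch 2 9 (Cert [(10, 10),
    (3, 3), (6, 6), (0, 2), (1, 5), (4, 8), (7, 9)]) (Cert [(2, 2), (6, 6), (8, 8), (3, 10), (0, 5), (1,
    7), (4, 9)]))) (Branch 2 9 (Cert [(10, 10), (4, 4), (6, 6), (0, 2), (1, 8), (3, 7), (5, 9)]) (Branch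
    2 8 (Cert [(0, 0), (6, 6), (9, 9), (2, 10), (1, 5), (3, 7), (4, 8)]) (Cert [(0, 0), (2, 2), (6, 6),
    (3, 10), (1, 7), (4, 8), (5, 9)])))))) (Branch 2 10 (Branch 5 9 (Branch 5 10 (Cert [(0, 0), (3, 3),
    (6, 6), (7, 10), (1, 5), (2, 8), (4, 9)]) (Cert [(0, 0), (3, 3), (6, 6), (5, 10), (1, 9), (2, 7),
    (4, 8)])) (Branch 2 5 (Branch 2 9 (Cert [(10, 10), (3, 3), (6, 6), (0, 5), (1, 8), (2, 7), (4, 9)])
   (Branch 5 7 (Cert [(0, 0), (3, 3), (6, 6), (4, 10), (1, 7), (2, 9), (5, 8)]) (Cert [(0, 0), (3, 3),
    (7, 7), (4, 10), (1, 6), (2, 9), (5, 8)]))) (Branch 5 7 (Branch 4 10 (Cert [(0, 0), (3, 3), (8, 8),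
    (6, 10), (1, 4), (2, 7), (5, 9)]) (Branch 7 9 (Cert [(0, 0), (4, 4), (6, 6), (3, 10), (1, 7), (2,
    8), (5, 9)]) (Branch 7 10 (Cert [(0, 0), (3, 3), (6, 6), (4, 10), (1, 5), (2, 8), (7, 9)]) (Cert
    [(0, 0), (6, 6), (9, 9), (4, 10), (1, 3), (2, 7), (5, 8)])))) (Branch 5 10 (Cert [(0, 0), (2, 2),
    (5, 5), (7, 7), (1, 6), (3, 8), (4, 9)]) (Branch 7 10 (Branch 3 6 (Cert [(0, 0), (2, 2), (4, 4), (5,
    10), (1, 7), (3, 8), (6, 9)]) (Cert [(0, 0), (2, 2), (8, 8), (5, 10), (1, 7), (3, 6), (4, 9)]))
   (Branch 6 10 (Cert [(0, 0), (2, 2), (5, 5), (7, 10), (1, 6), (3, 8), (4, 9)]) (Branch 7 9 (Branch 2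
    4 (Cert [(0, 0), (3, 3), (5, 5), (6, 10), (1, 9), (2, 7), (4, 8)]) (Cert [(0, 0), (5, 5), (8, 8),
    (3, 10), (1, 6), (2, 7), (4, 9)])) (Branch 6 9 (Cert [(0, 0), (5, 5), (7, 7), (3, 10), (1, 6), (2,
    8), (4, 9)]) (Cert [(0, 0), (5, 5), (7, 7), (3, 10), (1, 8), (2, 6), (4, 9)]))))))))) (Branch 6 8
   (Branch 2 8 (Branch 3 5 (Cert [(10, 10), (4, 4), (7, 7), (0, 2), (1, 3), (5, 8), (6, 9)]) (Cert
    [(10, 10), (3, 3), (7, 7), (0, 2), (1, 4), (5, 8), (6, 9)])) (Branch 2 9 (Branch 2 4 (Cert [(10,
    10), (3, 3), (5, 5), (0, 4), (1, 6), (2, 8), (7, 9)]) (Cert [(10, 10), (2, 2), (7, 7), (0, 3), (1,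
    6), (4, 9), (5, 8)])) (Branch 1 5 (Branch 1 9 (Cert [(10, 10), (2, 2), (6, 6), (0, 5), (1, 7), (3,
    8), (4, 9)]) (Cert [(0, 0), (2, 2), (7, 7), (3, 10), (1, 9), (4, 6), (5, 8)])) (Branch 3 6 (Branch 6
    10 (Cert [(0, 0), (2, 2), (4, 4), (5, 10), (1, 6), (3, 8), (7, 9)]) (Cert [(10, 10), (2, 2), (4, 4),
    (0, 3), (1, 6), (5, 8), (7, 9)])) (Branch 1 4 (Branch 1 9 (Cert [(10, 10), (2, 2), (5, 5), (0, 4),
    (1, 6), (3, 8), (7, 9)]) (Cert [(0, 0), (2, 2), (7, 7), (3, 10), (1, 6), (4, 9), (5, 8)])) (Cert
    [(0, 0), (2, 2), (7, 7), (3, 10), (1, 6), (4, 9), (5, 8)])))))) (Branch 2 8 (Branch 2 5 (Cert [(10,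
    10), (3, 3), (6, 6), (0, 2), (1, 4), (5, 8), (7, 9)]) (Cert [(0, 0), (5, 5), (9, 9), (3, 10), (1,
    4), (2, 7), (6, 8)])) (Branch 6 10 (Branch 3 6 (Cert [(0, 0), (2, 2), (4, 4), (3, 10), (1, 7), (5,
    9), (6, 8)]) (Cert [(0, 0), (2, 2), (7, 7), (3, 10), (1, 6), (4, 8), (5, 9)])) (Branch 2 9 (Branch 2
    4 (Cert [(10, 10), (6, 6), (8, 8), (0, 4), (1, 5), (2, 7), (3, 9)]) (Branch 6 9 (Cert [(10, 10), (2,
    2), (7, 7), (0, 3), (1, 6), (4, 9), (5, 8)]) (Cert [(10, 10), (2, 2), (6, 6), (0, 3), (1, 7), (4,
    9), (5, 8)]))) (Branch 6 9 (Branch 4 6 (Cert [(10, 10), (2, 2), (7, 7), (0, 3), (1, 6), (4, 8), (5,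
    9)]) (Cert [(0, 0), (2, 2), (6, 6), (3, 10), (1, 7), (4, 9), (5, 8)])) (Branch 1 5 (Branch 1 8 (Cert
    [(10, 10), (2, 2), (6, 6), (0, 3), (1, 7), (4, 8), (5, 9)]) (Cert [(0, 0), (2, 2), (6, 6), (3, 10),
    (1, 7), (4, 9), (5, 8)])) (Branch 3 7 (Branch 7 10 (Cert [(0, 0), (2, 2), (4, 4), (5, 10), (1, 7),
    (3, 8), (6, 9)]) (Cert [(10, 10), (2, 2), (4, 4), (0, 3), (1, 7), (5, 8), (6, 9)])) (Branch 1 4
   (Branch 1 9 (Cert [(10, 10), (2, 2), (5, 5), (0, 4), (1, 7), (3, 9), (6, 8)]) (Cert [(0, 0), (2, 2),
    (6, 6), (3, 10), (1, 7), (4, 9), (5, 8)])) (Cert [(0, 0), (2, 2), (6, 6), (3, 10), (1, 7), (4, 9),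
    (5, 8)])))))))))))))))))"

text \<open>The initial list says that vertex \<open>0\<close> has no neighbour among
  \<open>2\<close> to \<open>9\<close>; the choice of the first vertex in
  \<open>eleven_vertices_pair_model\<close> guarantees this.\<close>

lemma valid_cert11: "valid [] (map (Pair 0) [2..<10]) cert11"
  by code_simp

text \<open>The relation \<open>R\<close> selects one path through the tree, along which
  \<open>ps\<close> and \<open>ns\<close> stay truthful; at the leaf, an edge that crosses a known
  one must be absent.\<close>

lemma valid_sound:
  assumes "valid ps ns c"
    and nc: "\<And>a b c d. a < b \<Longrightarrow> b < c \<Longrightarrow> c < d \<Longrightarrow> d < (11::nat) \<Longrightarrow> R a c \<Longrightarrow> R b d \<Longrightarrow> False"
    and sym: "\<And>x y. R x y \<Longrightarrow> R y x" and irrefl: "\<And>x. \<not> R x x"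
    and "\<And>i j. (i, j) \<in> set ps \<Longrightarrow> i < 11 \<and> j < 11 \<and> R i j" "\<And>i j. (i, j) \<in> set ns \<Longrightarrow> \<not> R i j"
  shows "\<exists>M. pair_model {..<11} R M \<and> card M = 7"
  using assms(1,5,6)
proof (induction ps ns c rule: valid.induct)
  case (1 ps ns L)
  have cross: "\<not> R k l" if "crosses i j k l" "R i j" "i < 11" "j < 11" "k < 11" "l < 11" for i j k l
  proof
    assume kl: "R k l"
    have "R (min i j) (max i j)" "R (min k l) (max k l)"
      using that(2) kl sym by (auto simp: min_def max_def)
    then show False
      using that nc[of "min i j" "min k l" "max i j" "max k l"] nc[of "min k l" "min i j" "max k l" "max i j"]
      unfolding crosses_def by auto
  qed
  have absent: "\<not> R i j" if "absent ps ns i j" "i < 11" "j < 11" for i j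
    using that cross[of i j] "1.prems"(2,3) irrefl sym unfolding absent_def list_ex_iff by blast
  have inV: "x < 11 \<and> y < 11 \<and> \<not> R x y" if "(x, y) \<in> set L" for x y
    using "1.prems"(1) absent that by (auto simp: list_all_iff)
  have "sorted_wrt (separated ps ns) L" "length L = 7" using "1.prems"(1) by auto
  have "sorted_wrt (\<lambda>s t. {fst s, snd s} \<inter> {fst t, snd t} = {} \<and>
      \<not> (\<forall>x\<in>{fst s, snd s}. \<forall>y\<in>{fst t, snd t}. R x y)) L"
  proof (rule sorted_wrt_mono_rel[OF _ \<open>sorted_wrt (separated ps ns) L\<close>])
    fix s t assume st: "s \<in> set L" "t \<in> set L" "separated ps ns s t"
    obtain x y z w where eq: "s = (x, y)" "t = (z, w)" by fastforce
    have lt: "x < 11" "y < 11" "z < 11" "w < 11" using inV st(1,2) eq by auto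
    have "\<not> (R x z \<and> R x w \<and> R y z \<and> R y w)"
      using st(3) absent[OF _ lt(1,3)] absent[OF _ lt(1,4)] absent[OF _ lt(2,3)] absent[OF _ lt(2,4)]
        cross[OF _ _ lt(1,3,2,4)] cross[OF _ _ lt(1,4,2,3)] unfolding eq separated_def by auto
    then show "{fst s, snd s} \<inter> {fst t, snd t} = {} \<and>
      \<not> (\<forall>x\<in>{fst s, snd s}. \<forall>y\<in>{fst t, snd t}. R x y)"
      using st(3) unfolding eq separated_def by auto
  qed
  then show ?case
    using pair_model_of_list[of L "{..<11}" R] inV sym \<open>length L = 7\<close> by fastforce
next
  case (2 ps ns i j s t)
  show ?case
  proof (cases "R i j")
    case True
    show ?thesis by (rule "2.IH"(1)) (use 2 True in auto)
  next
    case False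
    show ?thesis by (rule "2.IH"(2)) (use 2 False in auto)
  qed
qed

section \<open>Vertices joined only to their neighbours on the circle\<close>

text \<open>Among the edges that jump over a vertex take a shortest one, and let \<open>v\<close> be
  the first vertex under it. An edge at \<open>v\<close> cannot leave this span without crossing,
  nor jump forward over a vertex, by minimality; so \<open>v\<close> is joined at most to its
  predecessor and its successor. When \<open>v\<close> is rotated to the front, these become the
  last and the second vertex. If no edge jumps over a vertex, the first vertex serves.\<close>

lemma noncrossing_ear:
  assumes nc: "noncrossing V R f" and sym: "\<And>x y. R x y \<Longrightarrow> R y x" and "finite V" "V \<noteq> {}"
  obtains g v where "noncrossing V R g" "v \<in> V" "\<And>x. x \<in> V \<Longrightarrow> g v \<le> g x"
    "\<And>x. x \<in> V \<Longrightarrow> R v x \<Longrightarrow> (\<forall>y\<in>V - {v}. g x \<le> g y) \<or> (\<forall>y\<in>V - {v}. g y \<le> g x)"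
proof -
  define S where "S = {(a, b). a \<in> V \<and> b \<in> V \<and> R a b \<and> f a < f b \<and> (\<exists>x\<in>V. f a < f x \<and> f x < f b)}"
  show ?thesis
  proof (cases "S = {}")
    case True
    obtain v where v: "v \<in> V" "\<And>x. x \<in> V \<Longrightarrow> f v \<le> f x"
      using ex_min_if_finite[of "f ` V"] assms by (metis (no_types, lifting) arg_min_if_finite(1) arg_min_least)
    have "f x \<le> f y" if "x \<in> V" "R v x" "y \<in> V - {v}" for x y
    proof (rule ccontr)
      assume "\<not> f x \<le> f y"
      moreover have "f v < f y" using v that noncrossing_inj[OF nc, of v y] by (metis DiffE insertI1 le_neq_implies_less)
      ultimately have "(v, x) \<in> S" using v that unfolding S_def by auto
      then show False using True by blast
    qed
    then show ?thesis using that[OF nc v] by blast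
  next
    case False
    then obtain a b where ab: "(a, b) \<in> S" and min: "\<And>c d. (c, d) \<in> S \<Longrightarrow> f b - f a \<le> f d - f c"
      using ex_has_least_nat[of "\<lambda>e. e \<in> S" _ "\<lambda>(c, d). f d - f c"] by (metis (mono_tags, lifting) case_prod_conv ex_in_conv surj_pair)
    define T where "T = {x \<in> V. f a < f x \<and> f x < f b}"
    have "finite T" "T \<noteq> {}" using ab \<open>finite V\<close> unfolding S_def T_def by auto
    then obtain v where v: "v \<in> T" "\<And>x. x \<in> T \<Longrightarrow> f v \<le> f x"
      by (metis arg_min_if_finite(1) arg_min_least)
    have abV: "a \<in> V" "b \<in> V" "R a b" "v \<in> V" "f a < f v" "f v < f b" using ab v unfolding S_def T_def by auto
    define M where "M = Suc (\<Sum>x\<in>V. f x)"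
    have M: "f x < M" if "x \<in> V" for x
      unfolding M_def using that \<open>finite V\<close> by (simp add: less_Suc_eq_le member_le_sum)
    define g where "g = (\<lambda>x. if f x < f v then f x + M else f x)"
    have gap: "f y \<le> f a" if "y \<in> V" "f y < f v" for y
      using v(2)[of y] that abV unfolding T_def by fastforce
    show ?thesis
    proof (rule that)
      show "noncrossing V R g" unfolding g_def by (rule noncrossing_rotate[OF nc sym M])
      show "v \<in> V" by fact
      show "g v \<le> g x" if "x \<in> V" for x using that M[OF abV(4)] by (auto simp: g_def)
      fix x assume x: "x \<in> V" "R v x"
      have "f a \<le> f x" using noncrossingD[OF nc x(1) abV(1,4,2)] abV x sym by (meson not_less)
      have "f x \<le> f b" using noncrossingD[OF nc abV(1,4,2) x(1)] abV x by (meson not_less)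
      show "(\<forall>y\<in>V - {v}. g x \<le> g y) \<or> (\<forall>y\<in>V - {v}. g y \<le> g x)"
      proof (cases "f x < f v")
        case True
        then have "f x = f a" using gap[OF x(1)] \<open>f a \<le> f x\<close> by simp
        have "g y \<le> g x" if "y \<in> V - {v}" for y
          using that gap[of y] M[of y] True \<open>f x = f a\<close> by (auto simp: g_def)
        then show ?thesis by blast
      next
        case False
        have "g x \<le> g y" if y: "y \<in> V - {v}" for y
        proof (rule ccontr)
          assume "\<not> g x \<le> g y"
          then have "f v < f y" "f y < f x"
            using False y M[OF x(1)] noncrossing_inj[OF nc, of v y] abV by (auto simp: g_def split: if_splits)
          then have "(v, x) \<in> S" using abV x y unfolding S_def by auto
          then show False using min \<open>f x \<le> f b\<close> abV by fastforce
        qed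
        then show ?thesis by blast
      qed
    qed
  qed
qed

lemma eleven_vertices_pair_model:
  assumes nc: "noncrossing V R f" and sym: "\<And>x y. R x y \<Longrightarrow> R y x" and irrefl: "\<And>x. \<not> R x x"
    and card: "card V = 11"
  shows "\<exists>M. pair_model V R M \<and> card M = 7"
proof -
  have fin: "finite V" "V \<noteq> {}" using card card.infinite by fastforce+
  obtain g v0 where g: "noncrossing V R g" and v0: "v0 \<in> V" "\<And>x. x \<in> V \<Longrightarrow> g v0 \<le> g x"
    "\<And>x. x \<in> V \<Longrightarrow> R v0 x \<Longrightarrow> (\<forall>y\<in>V - {v0}. g x \<le> g y) \<or> (\<forall>y\<in>V - {v0}. g y \<le> g x)"
    by (rule noncrossing_ear[OF nc sym fin]) (assumption | rule that)+
  have "inj_on g V" using g by (simp add: noncrossing_def)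
  then obtain v :: "nat \<Rightarrow> 'a" where v: "bij_betw v {..<11} V" and lt: "\<And>i j. i < j \<Longrightarrow> j < 11 \<Longrightarrow> g (v i) < g (v j)"
    using increasing_enumeration[of g V] fin card by auto
  have vV: "v i \<in> V" if "i < 11" for i using v that by (auto simp: bij_betw_def)
  have "v 0 = v0"
  proof -
    obtain i where i: "i < 11" "v i = v0" using v v0(1) by (metis bij_betw_imp_surj_on imageE lessThan_iff)
    then show ?thesis using v0(2)[OF vV[of 0]] lt[of 0 i] by (cases "i = 0") auto
  qed
  have ear: "\<not> R (v 0) (v j)" if "2 \<le> j" "j < 10" for j
  proof
    assume "R (v 0) (v j)"
    then have "(\<forall>y\<in>V - {v0}. g (v j) \<le> g y) \<or> (\<forall>y\<in>V - {v0}. g y \<le> g (v j))"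
      using v0(3) vV[of j] that \<open>v 0 = v0\<close> by simp
    moreover have "v k \<in> V - {v0}" if "0 < k" "k < 11" for k
      using lt[OF that] vV[OF that(2)] \<open>v 0 = v0\<close> by auto
    from this[of 1] this[of 10] have "v 1 \<in> V - {v0}" "v 10 \<in> V - {v0}" by simp_all
    ultimately have "g (v j) \<le> g (v 1) \<or> g (v 10) \<le> g (v j)" by blast
    then show False using lt[of 1 j] lt[of j 10] that by linarith
  qed
  let ?E = "\<lambda>i j. R (v i) (v j)"
  have "\<exists>M. pair_model {..<11} ?E M \<and> card M = 7"
  proof (rule valid_sound[of "[]" "map (Pair 0) [2..<10]" cert11])
    show "valid [] (map (Pair 0) [2..<10]) cert11" by (rule valid_cert11)
    show False if "a < b" "b < c" "c < d" "d < 11" "?E a c" "?E b d" for a b c d :: nat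
      using noncrossingD[OF g, of "v a" "v b" "v c" "v d"] that lt vV by auto
  qed (use sym irrefl ear in auto)
  then show ?thesis using pair_model_image[OF _ v] by metis
qed

subsection \<open>Graphs of diameter two\<close>

text \<open>The hypothesis says that edges only jump over \<open>z\<close>, so vertices at distance at least three in the
  order are nonadjacent.\<close>

lemma near_path_pair_model:
  fixes f :: "'a \<Rightarrow> nat"
  assumes "n \<ge> 7" "card W = 2 * n - 4" and sym: "\<And>x y. R x y \<Longrightarrow> R y x" and irrefl: "\<And>x. \<not> R x x"
    and "inj_on f W"
    and span: "\<And>x y w. x \<in> W \<Longrightarrow> y \<in> W \<Longrightarrow> w \<in> W \<Longrightarrow> R x y \<Longrightarrow> f x < f w \<Longrightarrow> f w < f y \<Longrightarrow> w = z"
  shows "\<exists>M. pair_model W R M \<and> card M = n"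
  using assms(1,2,5,6)
proof (induction n arbitrary: W rule: nat_induct_at_least)
  case base
  then have card: "card W = 10" by simp
  then have fin: "finite W" using card.infinite by fastforce
  obtain v :: "nat \<Rightarrow> 'a" where v: "bij_betw v {..<10} W" and lt: "\<And>i j. i < j \<Longrightarrow> j < 10 \<Longrightarrow> f (v i) < f (v j)"
    using increasing_enumeration[OF base(2) fin] card by auto
  have vW: "v i \<in> W" if "i < 10" for i using v that by (auto simp: bij_betw_def)
  let ?E = "\<lambda>i j. R (v i) (v j)"
  have sp: "v k = z" if "i < k" "k < j" "j < 10" "?E i j" for i j k
    using base(3)[of "v i" "v j" "v k"] vW lt that by auto
  have ne: "v k \<noteq> v l" if "k < l" "l < 10" for k l using lt[OF that] by auto
  have far: "\<not> ?E i j" if "i + 3 \<le> j" "j < 10" for i j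
    using sp[of i "i + 1" j] sp[of i "i + 2" j] ne[of "i + 1" "i + 2"] that by auto
  have far': "\<not> ?E j i" if "i + 3 \<le> j" "j < 10" for i j using far[OF that] sym by blast
  \<comment> \<open>Two edges of span two meeting in \<open>j\<close> would jump over two different
    vertices, but only \<open>z\<close> may be jumped over.\<close>
  have near: "\<not> (?E j i \<and> ?E j k)" if "j = i + 2" "k = i + 4" "i < 6" for i j k
    using sp[of i "i + 1" j] sp[of j "i + 3" k] ne[of "i + 1" "i + 3"] sym[of "v j" "v i"] that by fastforce
  have near': "\<not> (?E 3 1 \<and> ?E 3 5)" "\<not> (?E 6 4 \<and> ?E 6 8)" by (rule near; simp)+
  \<comment> \<open>Four singletons and three pairs use up the ten vertices. Any two blocks contain
    vertices at least three apart, except \<open>3\<close> against \<open>{1, 5}\<close> and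
    \<open>6\<close> against \<open>{4, 8}\<close>, which are covered by
    \<open>near'\<close>.\<close>
  define L :: "(nat \<times> nat) list" where "L = [(0, 0), (3, 3), (6, 6), (9, 9), (1, 5), (2, 7), (4, 8)]"
  have "\<exists>M. pair_model {..<10} ?E M \<and> card M = length L"
  proof (rule pair_model_of_list)
    show "x \<in> {..<10} \<and> y \<in> {..<10} \<and> \<not> ?E x y" if "(x, y) \<in> set L" for x y
      using that by (auto simp: L_def irrefl far)
    show "?E y x" if "?E x y" for x y using that by (rule sym)
    show "sorted_wrt (\<lambda>s t. {fst s, snd s} \<inter> {fst t, snd t} = {} \<and>
        \<not> (\<forall>x\<in>{fst s, snd s}. \<forall>y\<in>{fst t, snd t}. ?E x y)) L"
      using near' by (simp add: L_def far far')
  qed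
  moreover have "length L = 7" by (simp add: L_def)
  ultimately show ?case using pair_model_image[OF _ v] by metis
next
  case (Suc n)
  have card: "card W = 2 * n - 2" "card W \<ge> 12" using Suc by auto
  then have fin: "finite W" using card.infinite by fastforce
  obtain v where v: "bij_betw v {..<card W} W" and lt: "\<And>i j. i < j \<Longrightarrow> j < card W \<Longrightarrow> f (v i) < f (v j)"
    using increasing_enumeration[OF Suc.prems(2) fin] by auto
  have vW: "v i \<in> W" if "i < card W" for i using v that by (auto simp: bij_betw_def)
  define l where "l = card W - 1"
  have l: "l < card W" "l > 10" using card by (auto simp: l_def)
  have W: "v 0 \<in> W" "v l \<in> W" "v 0 \<noteq> v l" using vW[of 0] vW[of l] lt[of 0 l] l by auto
  have sp: "v k = z" if "i < k" "k < j" "j < card W" "R (v i) (v j)" for i j k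
    using Suc.prems(3)[of "v i" "v j" "v k"] vW lt that by auto
  have ne: "v k \<noteq> v m" if "k < m" "m < card W" for k m using lt[OF that] by auto
  have "\<not> R (v 0) (v l)" using sp[of 0 1 l] sp[of 0 2 l] ne[of 1 2] l by auto
  moreover have "\<not> (R (v 0) w \<and> R w (v l))" if w: "w \<in> W - {v 0, v l}" for w
  proof
    assume R: "R (v 0) w \<and> R w (v l)"
    have "w \<in> v ` {..<card W}" using v w by (simp add: bij_betw_def)
    then obtain i where i: "i < card W" "w = v i" by blast
    have "i \<noteq> 0" "i \<noteq> l" using w i(2) by (intro notI; simp)+
    then have "0 < i" "i < l" using i l by (auto simp: l_def)
    \<comment> \<open>The position \<open>i\<close> is at least three away from one of the ends
      \<open>0\<close> and \<open>l\<close>, so two vertices would be jumped over.\<close>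
    show False
    proof (cases "i > 2")
      case True
      then show False using sp[of 0 1 i] sp[of 0 2 i] ne[of 1 2] R i by auto
    next
      case False
      then show False using sp[of i 3 l] sp[of i 4 l] ne[of 3 4] R i l by auto
    qed
  qed
  moreover obtain M where "pair_model (W - {v 0, v l}) R M" "card M = n"
  proof -
    have "card (W - {v 0, v l}) = 2 * n - 4" using W card by (simp add: card_Diff_subset)
    moreover have "inj_on f (W - {v 0, v l})" using Suc.prems(2) by (rule inj_on_subset) blast
    ultimately show ?thesis using Suc.IH[of "W - {v 0, v l}"] Suc.prems(3) that by (metis DiffD1)
  qed
  ultimately show ?case
    using pair_model_insert[of W "v 0" "v l" R M] W fin sym by metis
qed

text \<open>As \<open>v\<close> sees at most \<open>a\<close> and \<open>b\<close>, diameter two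
  makes every other vertex a neighbour of \<open>a\<close> or \<open>b\<close>. Let
  \<open>a\<close>, but not \<open>b\<close>, see \<open>x1\<close>, \<open>x2\<close>,
  \<open>x3\<close>; the edges from \<open>a\<close> to these vertices act as fences. An inner
  vertex \<open>y\<close> not seen by \<open>a\<close> would lie behind \<open>x3\<close>, and a
  common neighbour of \<open>x1\<close> and \<open>y\<close> would force a crossing with a fence.
  Hence \<open>a\<close> is the hub, with \<open>b\<close> as the possible exception.\<close>

lemma ear_hub:
  fixes f :: "'a \<Rightarrow> nat"
  assumes nc: "noncrossing V R f" and sym: "\<And>x y. R x y \<Longrightarrow> R y x"
    and V: "v \<in> V" "a \<in> V" "b \<in> V" "v \<noteq> a" "v \<noteq> b" and "a \<noteq> b"
    and ear: "\<And>x. x \<in> V \<Longrightarrow> R v x \<Longrightarrow> x = a \<or> x = b"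
    and between: "\<And>x. x \<in> V - {v, a, b} \<Longrightarrow> f a < f x \<and> f x < f b"
    and diam: "\<And>x y. x \<in> V \<Longrightarrow> y \<in> V \<Longrightarrow> x \<noteq> y \<Longrightarrow> \<not> R x y \<Longrightarrow> \<exists>w\<in>V. R x w \<and> R w y"
    and card: "card {x \<in> V - {v, a, b}. \<not> R b x} \<ge> 3"
  shows "\<exists>h\<in>V. \<exists>z. \<forall>x\<in>V - {h}. \<not> R h x \<longrightarrow> x = z"
proof -
  define A where "A = {x \<in> V - {v, a, b}. \<not> R b x}"
  have hit: "R v a \<and> R a x \<or> R v b \<and> R b x" if "x \<in> V - {v, a, b}" for x
    using diam[OF V(1), of x] that ear by blast
  have "finite A" "card A \<ge> 3" using card unfolding A_def by (auto intro: card_ge_0_finite)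
  obtain v' where v': "bij_betw v' {..<card A} A" "\<And>i j. i < j \<Longrightarrow> j < card A \<Longrightarrow> f (v' i) < f (v' j)"
  proof (rule increasing_enumeration[rotated])
    show "inj_on f A" using nc unfolding noncrossing_def A_def by (auto intro: inj_on_subset)
    show "finite A" by fact
  qed (rule that)
  define x1 x2 x3 where "x1 = v' 0" and "x2 = v' 1" and "x3 = v' 2"
  have "v' i \<in> A" if "i < 3" for i using v'(1) that \<open>card A \<ge> 3\<close> by (auto simp: bij_betw_def)
  then have x: "x1 \<in> A" "x2 \<in> A" "x3 \<in> A" by (auto simp: x1_def x2_def x3_def)
  have lt: "f x1 < f x2" "f x2 < f x3" using v'(2) \<open>card A \<ge> 3\<close> by (auto simp: x1_def x2_def x3_def)
  have xV: "x1 \<in> V" "x2 \<in> V" "x3 \<in> V" and nb: "\<not> R b x1" using x by (auto simp: A_def)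
  have R: "R v a" "R a x1" "R a x2" "R a x3" using x hit unfolding A_def by blast+
  have ax: "f a < f x1" using x between by (auto simp: A_def)
  have "R a y" if y: "y \<in> V - {v, a, b}" for y
  proof (rule ccontr)
    assume nay: "\<not> R a y"
    then have Rby: "R b y" using hit y by blast
    have "f x3 < f y"
    proof (rule ccontr)
      assume "\<not> f x3 < f y"
      then have "f y < f x3" using noncrossing_inj[OF nc, of x3 y] y xV R nay by (metis DiffD1 linorder_neqE_nat)
      moreover have "f x3 < f b" using x between by (auto simp: A_def)
      ultimately show False using noncrossingD[OF nc V(2) _ xV(3) V(3), of y] between y R(4) Rby sym by blast
    qed
    have "\<not> R x1 y"
      using noncrossingD[OF nc V(2) xV(1,2), of y] y ax lt \<open>f x3 < f y\<close> R by auto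
    moreover have "x1 \<noteq> y" using lt \<open>f x3 < f y\<close> by auto
    ultimately obtain w where w: "w \<in> V" "R x1 w" "R w y" using diam[OF xV(1), of y] y by blast
    have "w \<noteq> v" using w(2) ear[OF xV(1)] sym x by (auto simp: A_def)
    moreover have "w \<noteq> a" "w \<noteq> b" using w nay nb sym by auto
    ultimately have wI: "w \<in> V - {v, a, b}" using w by blast
    \<comment> \<open>Up to \<open>x2\<close>, the edge from \<open>w\<close> to \<open>y\<close>
      crosses that from \<open>a\<close> to \<open>x3\<close>; beyond \<open>x2\<close>, the edge
      from \<open>x1\<close> to \<open>w\<close> crosses that from \<open>a\<close> to
      \<open>x2\<close>.\<close>
    show False
    proof (cases "f w \<le> f x2")
      case True
      then show False
        using noncrossingD[OF nc V(2) w(1) xV(3), of y] between[OF wI] lt \<open>f x3 < f y\<close> y R w by auto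
    next
      case False
      then show False
        using noncrossingD[OF nc V(2) xV(1,2) w(1)] ax lt R w by auto
    qed
  qed
  then have "\<forall>x\<in>V - {a}. \<not> R a x \<longrightarrow> x = b" using R(1) sym by blast
  then show ?thesis using V by blast
qed

text \<open>Each vertex other than \<open>v\<close>, \<open>a\<close>, \<open>b\<close> is adjacent
  to \<open>a\<close> or \<open>b\<close>, and at most one to both, since two such vertices would
  give crossing edges. If neither \<open>a\<close> nor \<open>b\<close> had three exclusive
  neighbours, there would be at most \<open>2 + 2 + 1\<close> of these vertices, but nine vertices
  in all leave six.\<close>

lemma noncrossing_hub:
  fixes f :: "'a \<Rightarrow> nat"
  assumes nc: "noncrossing V R f" and sym: "\<And>x y. R x y \<Longrightarrow> R y x" and irrefl: "\<And>x. \<not> R x x"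
    and fin: "finite V" "card V \<ge> 9"
    and diam: "\<And>x y. x \<in> V \<Longrightarrow> y \<in> V \<Longrightarrow> x \<noteq> y \<Longrightarrow> \<not> R x y \<Longrightarrow> \<exists>w\<in>V. R x w \<and> R w y"
  shows "\<exists>h\<in>V. \<exists>z. \<forall>x\<in>V - {h}. \<not> R h x \<longrightarrow> x = z"
proof -
  have "V \<noteq> {}" using fin by auto
  obtain g v where g: "noncrossing V R g" and v: "v \<in> V" "\<And>x. x \<in> V \<Longrightarrow> g v \<le> g x"
    and ear: "\<And>x. x \<in> V \<Longrightarrow> R v x \<Longrightarrow> (\<forall>y\<in>V - {v}. g x \<le> g y) \<or> (\<forall>y\<in>V - {v}. g y \<le> g x)"
    by (rule noncrossing_ear[OF nc sym fin(1) \<open>V \<noteq> {}\<close>]) (assumption | rule that)+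
  have "card (V - {v}) \<noteq> 0" using fin v(1) by simp
  then have W: "finite (V - {v})" "V - {v} \<noteq> {}" using fin(1) by (simp, metis card.empty)
  obtain a where a: "a \<in> V - {v}" "\<And>x. x \<in> V - {v} \<Longrightarrow> g a \<le> g x"
    using W by (metis arg_min_if_finite(1) arg_min_least)
  obtain b where b: "b \<in> V - {v}" "\<And>x. x \<in> V - {v} \<Longrightarrow> g x \<le> g b"
  proof -
    have "Max (g ` (V - {v})) \<in> g ` (V - {v})" using W by (intro Max_in) auto
    then obtain b where "b \<in> V - {v}" "g b = Max (g ` (V - {v}))" by force
    then show ?thesis using that[of b] W by simp
  qed
  define I where "I = V - {v, a, b}"
  have "a \<noteq> b"
  proof
    assume "a = b"
    then have "g x = g a" if "x \<in> V - {v}" for x using a(2)[OF that] b(2)[OF that] by simp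
    then have "V - {v} \<subseteq> {a}" using noncrossing_inj[OF g] a(1) by blast
    then have "card (V - {v}) \<le> 1" using card_mono[of "{a}" "V - {v}"] by simp
    then show False using fin v(1) by simp
  qed
  have inI: "g a < g x \<and> g x < g b" if "x \<in> I" for x
    using that a b noncrossing_inj[OF g, of a x] noncrossing_inj[OF g, of x b] unfolding I_def
    by (metis (no_types, lifting) Diff_iff insert_iff le_neq_implies_less)
  have ear': "x = a \<or> x = b" if "x \<in> V" "R v x" for x
  proof -
    have "x \<in> V - {v}" using that irrefl by blast
    then have "g x \<le> g a \<or> g b \<le> g x" using ear[OF that] a(1) b(1) by blast
    moreover have "g a < g x \<and> g x < g b" if "x \<noteq> a" "x \<noteq> b"
      using inI[of x] that \<open>x \<in> V - {v}\<close> by (simp add: I_def)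
    ultimately show ?thesis by linarith
  qed
  have hit: "R a x \<or> R b x" if "x \<in> I" for x
    using diam[OF v(1), of x] that ear' unfolding I_def by blast
  define A B C where "A = {x \<in> I. \<not> R b x}" and "B = {x \<in> I. \<not> R a x}" and "C = {x \<in> I. R a x \<and> R b x}"
  consider "card A \<ge> 3" | "card B \<ge> 3" | "card A \<le> 2" "card B \<le> 2" by linarith
  then show ?thesis
  proof cases
    case 1
    show ?thesis
      by (rule ear_hub[OF g sym, of v a b]) (use v(1) a(1) b(1) \<open>a \<noteq> b\<close> ear' inI diam 1 in \<open>auto simp: A_def I_def\<close>)
  next
    case 2
    \<comment> \<open>Reversing the order exchanges the roles of \<open>a\<close> and
      \<open>b\<close>.\<close>
    define g' where "g' x = Max (g ` V) - g x" for x
    have le: "g x \<le> Max (g ` V)" if "x \<in> V" for x using that fin by simp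
    have rev: "g' x < g' y \<longleftrightarrow> g y < g x" if "x \<in> V" "y \<in> V" for x y
      using le[OF that(1)] le[OF that(2)] by (auto simp: g'_def)
    have "noncrossing V R g'"
      unfolding noncrossing_def
    proof (intro conjI ballI impI notI)
      show "inj_on g' V" by (rule inj_onI) (metis g less_irrefl linorder_neqE_nat noncrossing_inj rev)
      show False if "p \<in> V" "q \<in> V" "r \<in> V" "s \<in> V" "g' p < g' q" "g' q < g' r" "g' r < g' s" "R p r" "R q s" for p q r s
        using noncrossingD[OF g, of s r q p] that rev sym by auto
    qed
    then show ?thesis
      by (rule ear_hub[of V R g' v b a])
        (use v(1) a(1) b(1) \<open>a \<noteq> b\<close> sym ear' inI diam 2 rev in \<open>auto simp: B_def I_def insert_commute\<close>)
  next
    case 3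
    have "card C \<le> 1"
    proof (rule ccontr)
      assume "\<not> card C \<le> 1"
      then obtain x y where xy: "x \<in> C" "y \<in> C" "x \<noteq> y"
        by (metis One_nat_def card_le_Suc0_iff_eq card.infinite le0 )
      have no: False if "x \<in> C" "y \<in> C" "g x < g y" for x y
        using noncrossingD[OF g, of a x y b] that inI a b sym unfolding C_def I_def by auto
      have "g x \<noteq> g y" using noncrossing_inj[OF g, of x y] xy unfolding C_def I_def by auto
      then show False using no[of x y] no[of y x] xy by linarith
    qed
    have "I = A \<union> B \<union> C" using hit unfolding A_def B_def C_def by blast
    then have "card I \<le> card A + card B + card C"
      by (metis (no_types, lifting) add_mono_thms_linordered_semiring(3) card_Un_le le_trans)
    moreover have "card I = card V - 3"
      using v(1) a(1) b(1) \<open>a \<noteq> b\<close> unfolding I_def by (subst card_Diff_subset) auto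
    ultimately show ?thesis using 3 fin \<open>card C \<le> 1\<close> by simp
  qed
qed

theorem noncrossing_pair_model:
  fixes f :: "'a \<Rightarrow> nat"
  assumes "n \<ge> 7" "card V = 2 * n - 3" and nc: "noncrossing V R f"
    and sym: "\<And>x y. R x y \<Longrightarrow> R y x" and irrefl: "\<And>x. \<not> R x x"
  shows "\<exists>M. pair_model V R M \<and> card M = n"
  using assms(1-3)
proof (induction n arbitrary: V rule: nat_induct_at_least)
  case base
  then show ?case using eleven_vertices_pair_model[OF base(2) sym irrefl] by simp
next
  case (Suc n)
  have card: "card V = 2 * n - 1" "card V \<ge> 13" using Suc by auto
  then have fin: "finite V" using card.infinite by fastforce
  show ?case
  proof (cases "\<exists>u\<in>V. \<exists>v\<in>V. u \<noteq> v \<and> \<not> R u v \<and> (\<forall>w\<in>V. \<not> (R u w \<and> R w v))")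
    case True
    then obtain u v where uv: "u \<in> V" "v \<in> V" "u \<noteq> v" "\<not> R u v" "\<And>w. w \<in> V \<Longrightarrow> \<not> (R u w \<and> R w v)" by blast
    have "card (V - {u, v}) = 2 * n - 3" using uv card by (simp add: card_Diff_subset)
    then obtain M where "pair_model (V - {u, v}) R M" "card M = n"
      using Suc.IH[of "V - {u, v}"] noncrossing_subset[OF Suc.prems(2), of "V - {u, v}"] by blast
    then show ?thesis using pair_model_insert[of V u v R M] uv fin sym by (metis DiffD1)
  next
    case False
    have "\<exists>h\<in>V. \<exists>z. \<forall>x\<in>V - {h}. \<not> R h x \<longrightarrow> x = z"
    proof (rule noncrossing_hub[OF Suc.prems(2) sym irrefl fin])
      show "9 \<le> card V" using card by simp
      show "\<exists>w\<in>V. R x w \<and> R w y" if "x \<in> V" "y \<in> V" "x \<noteq> y" "\<not> R x y" for x y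
        using False that by blast
    qed
    then obtain h z where h: "h \<in> V" and hub: "\<And>x. x \<in> V - {h} \<Longrightarrow> \<not> R h x \<Longrightarrow> x = z" by blast
    obtain g where g: "noncrossing V R g" and first: "\<And>x. x \<in> V \<Longrightarrow> g h \<le> g x"
      using noncrossing_rotate_first[OF Suc.prems(2) sym fin] by blast
    have "\<exists>M. pair_model (V - {h}) R M \<and> card M = Suc n"
    proof (rule near_path_pair_model[where f = g and z = z])
      show "card (V - {h}) = 2 * Suc n - 4" using h card by simp
      show "inj_on g (V - {h})" using g unfolding noncrossing_def by (meson Diff_subset inj_on_subset)
      \<comment> \<open>With \<open>h\<close> in first position, an edge from \<open>x\<close> to
        \<open>y\<close> jumping over \<open>w\<close> would cross an edge from \<open>h\<close> to
        \<open>w\<close>; so \<open>w\<close> must be the one exception.\<close>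
      show "w = z" if "x \<in> V - {h}" "y \<in> V - {h}" "w \<in> V - {h}" "R x y" "g x < g w" "g w < g y" for x y w
      proof (rule hub)
        have "g h < g x" using first[of x] noncrossing_inj[OF g h, of x] that by fastforce
        then show "\<not> R h w" using noncrossingD[OF g h, of x w y] that by blast
      qed fact
    qed (use Suc sym irrefl in auto)
    then obtain M where M: "pair_model (V - {h}) R M" "card M = Suc n" by blast
    have "pair_model V R M" by (rule pair_model_mono[OF M(1)]) auto
    then show ?thesis using M(2) by blast
  qed
qed

subsection \<open>From branch sets to minors\<close>

lemma minor_step_delete_vertices:
  assumes "finite D" "D \<subseteq> verts G"
  shows "minor_step\<^sup>*\<^sup>* G (verts G - D, {e \<in> edges G. e \<inter> D = {}})"
  using assms
proof (induction D rule: finite_induct)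
  case empty
  then show ?case by simp
next
  case (insert d D)
  let ?H = "(verts G - D, {e \<in> edges G. e \<inter> D = {}})"
  have "minor_step ?H (verts ?H - {d}, {e \<in> edges ?H. d \<notin> e})"
    using insert by (intro delete_vertex) auto
  moreover have "verts ?H - {d} = verts G - insert d D" by auto
  moreover have "{e \<in> edges ?H. d \<notin> e} = {e \<in> edges G. e \<inter> insert d D = {}}" by auto
  ultimately have "minor_step ?H (verts G - insert d D, {e \<in> edges G. e \<inter> insert d D = {}})"
    by metis
  then show ?case using insert by (meson insert_subset rtranclp.rtrancl_into_rtrancl)
qed

lemma clique_is_minor:
  assumes G: "simple_graph G" and K: "K \<subseteq> verts G"
    and clique: "\<And>x y. x \<in> K \<Longrightarrow> y \<in> K \<Longrightarrow> x \<noteq> y \<Longrightarrow> {x, y} \<in> edges G"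
  shows "is_minor (complete_graph (card K)) G"
proof -
  define E where "E = {e \<in> edges G. e \<inter> (verts G - K) = {}}"
  have "finite K" using G K by (auto simp: simple_graph_def finite_subset)
  have "minor_step\<^sup>*\<^sup>* G (verts G - (verts G - K), E)"
    unfolding E_def using G by (intro minor_step_delete_vertices) (auto simp: simple_graph_def)
  moreover have "verts G - (verts G - K) = K" using K by blast
  ultimately have "minor_step\<^sup>*\<^sup>* G (K, E)" by simp
  moreover have E: "E = {{x, y} | x y. x \<in> K \<and> y \<in> K \<and> x \<noteq> y}"
  proof (intro equalityI subsetI)
    fix e assume "e \<in> E"
    then have "e \<in> edges G" "e \<subseteq> K" "card e = 2" using G unfolding E_def simple_graph_def by blast+
    then show "e \<in> {{x, y} | x y. x \<in> K \<and> y \<in> K \<and> x \<noteq> y}" unfolding card_2_iff by blast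
  next
    fix e assume "e \<in> {{x, y} | x y. x \<in> K \<and> y \<in> K \<and> x \<noteq> y}"
    then show "e \<in> E" using clique unfolding E_def by blast
  qed
  moreover have "graph_isomorphic (K, E) (complete_graph (card K))"
  proof -
    obtain f where f: "bij_betw f K {..<card K}"
      using ex_bij_betw_finite_nat[OF \<open>finite K\<close>] by (auto simp: atLeast0LessThan)
    have "edges (complete_graph (card K)) = (`) f ` E"
    proof (intro equalityI subsetI)
      fix e assume "e \<in> edges (complete_graph (card K))"
      then obtain i j where ij: "e = {i, j}" "i < card K" "j < card K" "i \<noteq> j" by (auto simp: complete_graph_def)
      then obtain x y where "x \<in> K" "y \<in> K" "f x = i" "f y = j"
        using f by (metis bij_betw_imp_surj_on imageE lessThan_iff)
      then have "{x, y} \<in> E" "e = f ` {x, y}" using ij unfolding E by auto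
      then show "e \<in> (`) f ` E" by blast
    next
      fix e assume "e \<in> (`) f ` E"
      then obtain x y where xy: "x \<in> K" "y \<in> K" "x \<noteq> y" "e = {f x, f y}" unfolding E by auto
      then have "f x < card K" "f y < card K" "f x \<noteq> f y"
        using f bij_betw_apply[OF f] bij_betw_imp_inj_on[OF f] by (auto simp: inj_on_eq_iff)
      then show "e \<in> edges (complete_graph (card K))" using xy by (auto simp: complete_graph_def)
    qed
    then show ?thesis using f unfolding graph_isomorphic_def by (auto simp: complete_graph_def)
  qed
  ultimately show ?thesis unfolding is_minor_def by blast
qed

text \<open>With \<open>nonadj G\<close> for \<open>R\<close>, a \<open>pair_model\<close> consists
  of ordinary branch sets of \<open>G\<close>: single vertices or edges, any two of them joined by
  an edge.\<close>

definition nonadj :: "'a ugraph \<Rightarrow> 'a \<Rightarrow> 'a \<Rightarrow> bool" where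
  "nonadj G x y \<longleftrightarrow> x \<noteq> y \<and> {x, y} \<notin> edges G"

lemma contract_edge_simple:
  assumes "simple_graph G" "u \<in> verts G" "u \<noteq> v"
  shows "simple_graph (contract_edge u v G)"
  using assms unfolding simple_graph_def contract_edge_def by fastforce

lemma contract_edge_edgeI:
  assumes "{s, t} \<in> edges G" "t \<noteq> u" "t \<noteq> v" "s = v \<and> x = u \<or> s \<noteq> v \<and> x = s" "x \<noteq> t"
  shows "{x, t} \<in> edges (contract_edge u v G)"
proof -
  have "(\<lambda>x. if x = v then u else x) ` {s, t} = {x, t}" using assms by auto
  moreover have "card {x, t} = 2" using assms by simp
  ultimately show ?thesis unfolding contract_edge_def using assms(1) by (auto intro: rev_image_eqI)
qed

text \<open>Contracting the edge in a two-element block turns it into \<open>{u}\<close> and removes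
  \<open>v\<close> from the union of the blocks, whose size is the measure of the induction. Once
  all blocks are singletons, they form a clique.\<close>

lemma pair_model_is_minor:
  assumes "simple_graph G" "pair_model (verts G) (nonadj G) M"
  shows "is_minor (complete_graph (card M)) G"
  using assms
proof (induction "card (\<Union>M)" arbitrary: G M rule: less_induct)
  case less
  note M = less.prems(2)
  have finV: "finite (verts G)" using less.prems(1) by (simp add: simple_graph_def)
  have finM: "finite M" by (rule pair_model_finite[OF M finV])
  show ?case
  proof (cases "\<forall>B\<in>M. \<exists>x. B = {x}")
    case True
    have "card (\<Union>M) = card M"
    proof -
      have "card (\<Union>M) = (\<Sum>B\<in>M. card B)"
        by (rule card_Union_disjoint) (use True pair_modelD(1)[OF M] in \<open>auto simp: pairwise_def disjnt_def\<close>)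
      also have "\<dots> = (\<Sum>B\<in>M. 1)" using True by (intro sum.cong) auto
      finally show ?thesis by simp
    qed
    moreover have "\<Union>M \<subseteq> verts G" using pair_model_block_subset[OF M] by blast
    moreover have "{x, y} \<in> edges G" if xy: "x \<in> \<Union>M" "y \<in> \<Union>M" "x \<noteq> y" for x y
    proof -
      have "{x} \<in> M" "{y} \<in> M" using xy True by force+
      then show ?thesis using pair_modelD(2)[OF M, of "{x}" "{y}"] xy by (auto simp: nonadj_def)
    qed
    ultimately show ?thesis using clique_is_minor[OF less.prems(1)] by metis
  next
    case False
    then obtain B where B: "B \<in> M" "\<nexists>x. B = {x}" by blast
    then obtain u v where uv: "u \<in> verts G" "v \<in> verts G" "B = {u, v}" "\<not> nonadj G u v"
      using pair_modelE[OF M] by metis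
    have "u \<noteq> v" using B uv by auto
    then have e: "{u, v} \<in> edges G" using uv by (simp add: nonadj_def)
    define H where "H = contract_edge u v G"
    define M' where "M' = insert {u} (M - {B})"
    have other: "C \<subseteq> verts G - {u, v}" if "C \<in> M - {B}" for C
      using pair_modelD(1)[OF M, of C B] pair_model_block_subset[OF M, of C] that B(1) uv(3) by blast
    have step: "minor_step G H" unfolding H_def using e \<open>u \<noteq> v\<close> by (rule contract)
    have vH: "verts H = verts G - {v}" by (simp add: H_def contract_edge_def)
    have keep: "\<not> nonadj H x y" if "\<not> nonadj G x y" "x \<notin> {u, v}" "y \<notin> {u, v}" for x y
      using that contract_edge_edgeI[of x y G u v x] unfolding nonadj_def H_def by auto
    \<comment> \<open>After the contraction \<open>u\<close> inherits the neighbours of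
      \<open>v\<close>, so \<open>u\<close> alone keeps the old block joined to the others.\<close>
    have merge: "\<not> nonadj H u t" if "s \<in> {u, v}" "\<not> nonadj G s t" "t \<notin> {u, v}" for s t
      using that contract_edge_edgeI[of s t G u v u] unfolding nonadj_def H_def by auto
    have sym: "nonadj H x y \<longleftrightarrow> nonadj H y x" for x y by (auto simp: nonadj_def insert_commute)
    have "{u} \<notin> M - {B}" using other by blast
    then have card: "card M' = card M"
      unfolding M'_def using finM B(1) card.remove[of M B] by simp
    have un: "\<exists>t\<in>C. \<not> nonadj H u t" if C: "C \<in> M - {B}" for C
    proof -
      obtain s t where st: "s \<in> B" "t \<in> C" "\<not> nonadj G s t"
        using pair_modelD(2)[OF M, of B C] B(1) C by blast
      then show ?thesis using merge[of s t] other[OF C] uv(3) by blast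
    qed
    have "pair_model (verts H) (nonadj H) M'"
      unfolding pair_model_def
    proof (intro conjI ballI impI)
      fix C assume "C \<in> M'"
      then consider "C = {u}" | "C \<in> M - {B}" unfolding M'_def by blast
      then show "\<exists>x\<in>verts H. \<exists>y\<in>verts H. C = {x, y} \<and> \<not> nonadj H x y"
      proof cases
        case 1
        then show ?thesis using uv \<open>u \<noteq> v\<close> vH by (intro bexI[of _ u]) (auto simp: nonadj_def)
      next
        case 2
        then have "C \<in> M" by simp
        then obtain x y where xy: "C = {x, y}" "\<not> nonadj G x y" by (rule pair_modelE[OF M])
        have "x \<in> verts G - {u, v}" "y \<in> verts G - {u, v}" using other[OF 2] unfolding xy(1) by simp_all
        moreover from this have "\<not> nonadj H x y" by (intro keep xy(2)) simp_all
        ultimately show ?thesis unfolding vH xy(1) by (intro bexI[of _ x] bexI[of _ y] conjI) simp_all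
      qed
    next
      fix C D assume CD: "C \<in> M'" "D \<in> M'" "C \<noteq> D"
      then consider "C = {u}" "D \<in> M - {B}" | "C \<in> M - {B}" "D = {u}" | "C \<in> M - {B}" "D \<in> M - {B}"
        unfolding M'_def by blast
      then have "C \<inter> D = {} \<and> (\<exists>x\<in>C. \<exists>y\<in>D. \<not> nonadj H x y)"
      proof cases
        case 1
        then show ?thesis using un[of D] other[of D] by auto
      next
        case 2
        then show ?thesis using un[of C] other[of C] sym by auto
      next
        case 3
        then obtain x y where "x \<in> C" "y \<in> D" "\<not> nonadj G x y" using pair_modelD(2)[OF M, of C D] CD(3) by blast
        moreover from this have "\<not> nonadj H x y" using 3 other keep by blast
        ultimately show ?thesis using pair_modelD(1)[OF M, of C D] 3 CD(3) by blast
      qed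
      then show "C \<inter> D = {}" "\<exists>x\<in>C. \<exists>y\<in>D. \<not> nonadj H x y" by blast+
    qed
    moreover have "card (\<Union>M') < card (\<Union>M)"
    proof (rule psubset_card_mono)
      show "finite (\<Union>M)" using finM finV pair_model_block_subset[OF M] by (meson finite_Union finite_subset)
      have "v \<in> \<Union>M" "v \<notin> \<Union>M'" using B(1) uv(3) other \<open>u \<noteq> v\<close> unfolding M'_def by blast+
      moreover have "\<Union>M' \<subseteq> \<Union>M" using B(1) uv(3) unfolding M'_def by blast
      ultimately show "\<Union>M' \<subset> \<Union>M" by blast
    qed
    moreover have "simple_graph H"
      unfolding H_def using less.prems(1) uv(1) \<open>u \<noteq> v\<close> by (rule contract_edge_simple)
    ultimately have "is_minor (complete_graph (card M)) H"
      using less.hyps[of M' H] card by simp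
    then show ?thesis
      using step unfolding is_minor_def by (meson converse_rtranclp_into_rtranclp)
  qed
qed

section \<open>From outerplanar drawings to complete minors of the complement\<close>

theorem outerplanar_noncrossing:
  assumes "outerplanar G"
  shows "\<exists>f. noncrossing (verts G) (\<lambda>x y. {x, y} \<in> edges G) f"
proof -
  obtain p \<gamma> F where G: "simple_graph G" "planar_embedding G p \<gamma>" "F \<in> faces G p \<gamma>" "p ` verts G \<subseteq> frontier F"
    using assms unfolding outerplanar_def by blast
  have "F \<subseteq> - drawing G p \<gamma>" "connected F"
    using G(3) unfolding faces_def by (auto simp: in_components_subset in_components_connected)
  then interpret outer_drawing "verts G" "edges G" p \<gamma> F
    using G by unfold_locales (auto simp: frontier_def)
  interpret outer_graph "verts G" adj
  proof
    show "finite (verts G)" using G(1) by (simp add: simple_graph_def)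
    show "adj y x" if "adj x y" for x y using that by (simp add: insert_commute)
    show "\<not> adj x x" for x using edge_card[of "{x, x}"] by auto
  qed (fact no_theta, fact no_crossing_chords)
  show ?thesis by (rule outer_graph_noncrossing)
qed

theorem theorem11:
  fixes n :: nat and G :: "'a ugraph"
  assumes "n \<ge> 7"
    and "maximal_outerplanar G"
    and "card (verts G) = 2 * n - 3"
  shows "is_minor (complete_graph n) (complement_graph G)"
proof -
  let ?R = "\<lambda>x y. {x, y} \<in> edges G"
  have G: "outerplanar G" using assms(2) by (simp add: maximal_outerplanar_def)
  then have simple: "simple_graph G" by (simp add: outerplanar_def)
  obtain f where "noncrossing (verts G) ?R f" using outerplanar_noncrossing[OF G] by blast
  moreover have "\<not> ?R x x" for x using simple by (force simp: simple_graph_def)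
  ultimately obtain M where M: "pair_model (verts G) ?R M" "card M = n"
    using noncrossing_pair_model[OF assms(1,3)] by (metis (no_types, lifting) insert_commute)
  have "simple_graph (complement_graph G)"
    using simple by (auto simp: simple_graph_def complement_graph_def)
  \<comment> \<open>Distinct vertices that are nonadjacent in the complement are adjacent in
    \<open>G\<close>, so on the vertices \<open>nonadj\<close> of the complement implies
    \<open>?R\<close>.\<close>
  moreover have "pair_model (verts (complement_graph G)) (nonadj (complement_graph G)) M"
    by (rule pair_model_mono[OF M(1)]) (auto simp: nonadj_def complement_graph_def)
  ultimately show ?thesis using pair_model_is_minor[of "complement_graph G" M] M(2) by simp
qed

end
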